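(* Let $A_S$ be a large-type Artin group, let $X\subseteq S$, and let $A_X$ be the corresponding standard parabolic subgroup. Then $A_X$ is not conjugacy stable in $A_S$ if and only if there exist vertices $a$ and $b$ of $\Gamma_X$ that are connected by an odd-labelled path in $\Gamma_S$ and that are not connected by an odd-labelled path in $\Gamma_X$.
   Context: Artin groups: let $S$ be a finite set and for all distinct $s,t\in S$ let $m_{st}=m_{ts}\in\{2,3,\dots,\infty\}$. The Artin group is $A_S=\langle S \mid \underbrace{sts\cdots}_{m_{st}}=\underbrace{tst\cdots}_{m_{st}} \text{ whenever } m_{st}\neq\infty\rangle$. It is of large type if $m_{st}\ge 3$ for all distinct $s,t\in S$. For $X\subseteq S$, $A_X$ is the subgroup generated by $X$ (a standard parabolic subgroup; it is known to be isomorphic to the Artin group with the labels restricted to $X$). Coxeter graph: $\Gamma_S$ has vertex set $S$, with an edge labelled $m_{st}$ joining $s$ and $t$ iff $m_{st}\ne\infty$. $\Gamma_X$ is the Coxeter graph of $A_X$, i.e. the full labelled subgraph of $\Gamma_S$ on $X$. An odd-labelled path is an edge path all of whose edges have odd labels (the trivial path at a vertex is allowed). A subgroup $H$ of a group $G$ is conjugacy stable in $G$ if for all $a,b\in H$ such that $a=\alpha^{-1}b\alpha$ for some $\alpha\in G$, there is $\beta\in H$ with $a=\beta^{-1}b\beta$. *)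

theory Defs
  imports "HOL-Algebra.Generated_Groups" "HOL-Library.Extended_Nat"
begin

text \<open>A word over \<open>S\<close> and its formal inverses: the letter \<open>(s, True)\<close> stands for \<open>s\<close>
  and \<open>(s, False)\<close> for the inverse of \<open>s\<close>.\<close>

type_synonym 'a word = "('a \<times> bool) list"

definition words :: "'a set \<Rightarrow> 'a word set" where
  "words S = lists (S \<times> UNIV)"

text \<open>The least congruence on words over \<open>S\<close> that cancels \<open>s s\<^sup>-\<^sup>1\<close> and \<open>s\<^sup>-\<^sup>1 s\<close> and
  identifies \<open>l\<close> with \<open>r\<close> for every defining relation \<open>(l, r) \<in> R\<close>.\<close>

inductive_set pres_eq :: "'a set \<Rightarrow> ('a word \<times> 'a word) set \<Rightarrow> ('a word \<times> 'a word) set"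
  for S :: "'a set" and R :: "('a word \<times> 'a word) set"
where
  refl: "w \<in> words S \<Longrightarrow> (w, w) \<in> pres_eq S R"
| sym: "(v, w) \<in> pres_eq S R \<Longrightarrow> (w, v) \<in> pres_eq S R"
| trans: "(u, v) \<in> pres_eq S R \<Longrightarrow> (v, w) \<in> pres_eq S R \<Longrightarrow> (u, w) \<in> pres_eq S R"
| cancel: "s \<in> S \<Longrightarrow> u \<in> words S \<Longrightarrow> v \<in> words S
    \<Longrightarrow> (u @ [(s, e), (s, \<not> e)] @ v, u @ v) \<in> pres_eq S R"
| relation: "(l, r) \<in> R \<Longrightarrow> l \<in> words S \<Longrightarrow> r \<in> words S \<Longrightarrow> u \<in> words S \<Longrightarrow> v \<in> words S
    \<Longrightarrow> (u @ l @ v, u @ r @ v) \<in> pres_eq S R"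

definition presented_group :: "'a set \<Rightarrow> ('a word \<times> 'a word) set \<Rightarrow> 'a word set monoid" where
  "presented_group S R =
     \<lparr>carrier = words S // pres_eq S R,
      mult = (\<lambda>A B. pres_eq S R `` {a @ b | a b. a \<in> A \<and> b \<in> B}),
      one = pres_eq S R `` {[]}\<rparr>"

lemma words_simps [simp]:
  "[] \<in> words S"
  "x # w \<in> words S \<longleftrightarrow> fst x \<in> S \<and> w \<in> words S"
  "v @ w \<in> words S \<longleftrightarrow> v \<in> words S \<and> w \<in> words S"
  by (auto simp: words_def mem_Times_iff)

lemma pres_eq_words: "(v, w) \<in> pres_eq S R \<Longrightarrow> v \<in> words S \<and> w \<in> words S"
  by (induction rule: pres_eq.induct) auto

lemma equiv_pres_eq: "equiv (words S) (pres_eq S R)"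
proof (rule equivI)
  show "pres_eq S R \<subseteq> words S \<times> words S"
    using pres_eq_words by fast
  show "refl_on (words S) (pres_eq S R)"
    by (rule refl_onI) (rule pres_eq.refl)
  show "Relation.sym (pres_eq S R)"
    by (rule symI) (rule pres_eq.sym)
  show "Relation.trans (pres_eq S R)"
    by (rule transI) (rule pres_eq.trans)
qed

lemma pres_eq_context:
  assumes "(v, w) \<in> pres_eq S R" "p \<in> words S" "q \<in> words S"
  shows "(p @ v @ q, p @ w @ q) \<in> pres_eq S R"
  using assms
proof (induction rule: pres_eq.induct)
  case (refl w)
  then show ?case by (intro pres_eq.refl) simp
next
  case (sym v w)
  then show ?case by (blast intro: pres_eq.sym)
next
  case (trans u v w)
  then show ?case by (blast intro: pres_eq.trans)
next
  case (cancel s u v e)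
  then show ?case using pres_eq.cancel[of s S "p @ u" "v @ q" e R] by simp
next
  case (relation l r u v)
  then show ?case using pres_eq.relation[of l r R S "p @ u" "v @ q"] by simp
qed

lemma pres_eq_append:
  assumes "(v, v') \<in> pres_eq S R" "(w, w') \<in> pres_eq S R"
  shows "(v @ w, v' @ w') \<in> pres_eq S R"
proof -
  have "(v @ w, v' @ w) \<in> pres_eq S R"
    using pres_eq_context[OF assms(1), of "[]" w] pres_eq_words[OF assms(2)] by simp
  moreover have "(v' @ w, v' @ w') \<in> pres_eq S R"
    using pres_eq_context[OF assms(2), of v' "[]"] pres_eq_words[OF assms(1)] by simp
  ultimately show ?thesis by (rule pres_eq.trans)
qed

lemma presented_group_mult_class:
  assumes "v \<in> words S" "w \<in> words S"
  shows "pres_eq S R `` {v} \<otimes>\<^bsub>presented_group S R\<^esub> pres_eq S R `` {w} = pres_eq S R `` {v @ w}"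
proof -
  have "pres_eq S R `` {a @ b | a b. (v, a) \<in> pres_eq S R \<and> (w, b) \<in> pres_eq S R}
      = pres_eq S R `` {v @ w}" (is "?L = ?R")
  proof
    show "?L \<subseteq> ?R" by (auto intro: pres_eq.trans[OF pres_eq_append])
    show "?R \<subseteq> ?L" using assms by (auto intro: pres_eq.refl)
  qed
  then show ?thesis by (simp add: presented_group_def)
qed

definition inv_word :: "'a word \<Rightarrow> 'a word" where
  "inv_word w = rev (map (\<lambda>(s, e). (s, \<not> e)) w)"

lemma inv_word_words: "w \<in> words S \<Longrightarrow> inv_word w \<in> words S"
  by (auto simp: inv_word_def words_def)

lemma inv_word_cancel:
  "w \<in> words S \<Longrightarrow> (inv_word w @ w, []) \<in> pres_eq S R"
proof (induction w)
  case Nil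
  then show ?case by (simp add: inv_word_def pres_eq.refl)
next
  case (Cons x w)
  obtain s e where x: "x = (s, e)" by (cases x)
  have "(inv_word w @ [(s, \<not> e), (s, \<not> \<not> e)] @ w, inv_word w @ w) \<in> pres_eq S R"
    using Cons.prems x by (intro pres_eq.cancel) (auto intro: inv_word_words)
  with Cons x show ?case
    by (auto simp: inv_word_def intro: pres_eq.trans)
qed

lemma group_presented_group: "group (presented_group S R)"
proof -
  let ?G = "presented_group S R" and ?c = "\<lambda>w. pres_eq S R `` {w}"
  have car: "\<exists>w\<in>words S. x = ?c w" if "x \<in> carrier ?G" for x
    using that by (auto simp: presented_group_def quotient_def)
  have cI: "?c w \<in> carrier ?G" if "w \<in> words S" for w
    using that by (auto simp: presented_group_def quotient_def)
  have one: "\<one>\<^bsub>?G\<^esub> = ?c []"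
    by (simp add: presented_group_def)
  show ?thesis
  proof (rule groupI)
    fix x y assume "x \<in> carrier ?G" "y \<in> carrier ?G"
    then obtain v w where "v \<in> words S" "w \<in> words S" "x = ?c v" "y = ?c w"
      using car by meson
    then show "x \<otimes>\<^bsub>?G\<^esub> y \<in> carrier ?G"
      using cI[of "v @ w"] by (simp add: presented_group_mult_class)
  next
    show "\<one>\<^bsub>?G\<^esub> \<in> carrier ?G"
      using cI[of "[]"] by (simp add: one)
  next
    fix x y z assume "x \<in> carrier ?G" "y \<in> carrier ?G" "z \<in> carrier ?G"
    then obtain u v w where "u \<in> words S" "v \<in> words S" "w \<in> words S"
      "x = ?c u" "y = ?c v" "z = ?c w"
      using car by meson
    then show "x \<otimes>\<^bsub>?G\<^esub> y \<otimes>\<^bsub>?G\<^esub> z = x \<otimes>\<^bsub>?G\<^esub> (y \<otimes>\<^bsub>?G\<^esub> z)"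
      by (simp add: presented_group_mult_class)
  next
    fix x assume "x \<in> carrier ?G"
    then obtain w where w: "w \<in> words S" "x = ?c w"
      using car by meson
    then show "\<one>\<^bsub>?G\<^esub> \<otimes>\<^bsub>?G\<^esub> x = x"
      by (simp add: presented_group_mult_class one)
    have "?c (inv_word w) \<otimes>\<^bsub>?G\<^esub> x = ?c (inv_word w @ w)"
      using w by (simp add: presented_group_mult_class inv_word_words)
    also have "\<dots> = \<one>\<^bsub>?G\<^esub>"
      using w by (simp add: one equiv_class_eq[OF equiv_pres_eq] inv_word_cancel)
    finally show "\<exists>y\<in>carrier ?G. y \<otimes>\<^bsub>?G\<^esub> x = \<one>\<^bsub>?G\<^esub>"
      using cI w inv_word_words by meson
  qed
qed

text \<open>Only the values \<open>m s t\<close> for distinct \<open>s, t \<in> S\<close> carry meaning.\<close>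

definition artin_labels :: "'a set \<Rightarrow> ('a \<Rightarrow> 'a \<Rightarrow> enat) \<Rightarrow> bool" where
  "artin_labels S m \<longleftrightarrow> (\<forall>s\<in>S. \<forall>t\<in>S. s \<noteq> t \<longrightarrow> m s t = m t s \<and> 2 \<le> m s t)"

definition large_type :: "'a set \<Rightarrow> ('a \<Rightarrow> 'a \<Rightarrow> enat) \<Rightarrow> bool" where
  "large_type S m \<longleftrightarrow> (\<forall>s\<in>S. \<forall>t\<in>S. s \<noteq> t \<longrightarrow> 3 \<le> m s t)"

text \<open>The alternating word \<open>s t s \<dots>\<close> with \<open>n\<close> letters.\<close>

definition alternating :: "'a \<Rightarrow> 'a \<Rightarrow> nat \<Rightarrow> 'a word" where
  "alternating s t n = map (\<lambda>i. (if even i then s else t, True)) [0..<n]"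

definition artin_relations :: "'a set \<Rightarrow> ('a \<Rightarrow> 'a \<Rightarrow> enat) \<Rightarrow> ('a word \<times> 'a word) set" where
  "artin_relations S m =
     {(alternating s t n, alternating t s n) | s t n. s \<in> S \<and> t \<in> S \<and> s \<noteq> t \<and> m s t = enat n}"

definition artin_group :: "'a set \<Rightarrow> ('a \<Rightarrow> 'a \<Rightarrow> enat) \<Rightarrow> 'a word set monoid" where
  "artin_group S m = presented_group S (artin_relations S m)"

definition artin_gen :: "'a set \<Rightarrow> ('a \<Rightarrow> 'a \<Rightarrow> enat) \<Rightarrow> 'a \<Rightarrow> 'a word set" where
  "artin_gen S m s = pres_eq S (artin_relations S m) `` {[(s, True)]}"

definition standard_parabolic :: "'a set \<Rightarrow> ('a \<Rightarrow> 'a \<Rightarrow> enat) \<Rightarrow> 'a set \<Rightarrow> 'a word set set" where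
  "standard_parabolic S m X = generate (artin_group S m) (artin_gen S m ` X)"

lemma group_artin_group: "group (artin_group S m)"
  by (simp add: artin_group_def group_presented_group)

lemma artin_gen_carrier: "s \<in> S \<Longrightarrow> artin_gen S m s \<in> carrier (artin_group S m)"
  by (auto simp: artin_gen_def artin_group_def presented_group_def intro: quotientI)

lemma subgroup_standard_parabolic:
  "X \<subseteq> S \<Longrightarrow> subgroup (standard_parabolic S m X) (artin_group S m)"
  unfolding standard_parabolic_def
  by (intro group.generate_is_subgroup group_artin_group) (auto intro: artin_gen_carrier)

definition coxeter_edge :: "'a set \<Rightarrow> ('a \<Rightarrow> 'a \<Rightarrow> enat) \<Rightarrow> 'a \<Rightarrow> 'a \<Rightarrow> bool" where
  "coxeter_edge Y m s t \<longleftrightarrow> s \<in> Y \<and> t \<in> Y \<and> s \<noteq> t \<and> m s t \<noteq> \<infinity>"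

definition odd_edge :: "'a set \<Rightarrow> ('a \<Rightarrow> 'a \<Rightarrow> enat) \<Rightarrow> 'a \<Rightarrow> 'a \<Rightarrow> bool" where
  "odd_edge Y m s t \<longleftrightarrow> coxeter_edge Y m s t \<and> odd (the_enat (m s t))"

text \<open>A path is the nonempty list of the vertices it visits; a single vertex is the trivial path.\<close>

definition odd_path :: "'a set \<Rightarrow> ('a \<Rightarrow> 'a \<Rightarrow> enat) \<Rightarrow> 'a list \<Rightarrow> bool" where
  "odd_path Y m p \<longleftrightarrow> p \<noteq> [] \<and> set p \<subseteq> Y \<and> successively (odd_edge Y m) p"

definition odd_connected :: "'a set \<Rightarrow> ('a \<Rightarrow> 'a \<Rightarrow> enat) \<Rightarrow> 'a \<Rightarrow> 'a \<Rightarrow> bool" where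
  "odd_connected Y m a b \<longleftrightarrow> (\<exists>p. odd_path Y m p \<and> hd p = a \<and> last p = b)"

definition conjugacy_stable :: "('g, 'k) monoid_scheme \<Rightarrow> 'g set \<Rightarrow> bool" where
  "conjugacy_stable G H \<longleftrightarrow>
     (\<forall>a\<in>H. \<forall>b\<in>H. (\<exists>\<alpha>\<in>carrier G. a = inv\<^bsub>G\<^esub> \<alpha> \<otimes>\<^bsub>G\<^esub> b \<otimes>\<^bsub>G\<^esub> \<alpha>)
        \<longrightarrow> (\<exists>\<beta>\<in>H. a = inv\<^bsub>G\<^esub> \<beta> \<otimes>\<^bsub>G\<^esub> b \<otimes>\<^bsub>G\<^esub> \<beta>))"

end

theory Submission
  imports Defs Complex_Main
begin

text \<open>The heart of the matter is a retraction of words over \<open>S\<close> onto words over \<open>X\<close> that is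
  compatible with the defining relations; it is the combinatorial retraction of Charney and
  Paris onto a standard parabolic subgroup. Let \<open>W\<close> be the Coxeter group and \<open>W\<^sub>X\<close> its
  parabolic subgroup. A word is read letter by letter while a coset \<open>W\<^sub>X v\<close> is followed,
  \<open>v\<close> being its shortest element. A letter \<open>s\<close> with \<open>v s v\<^sup>-\<^sup>1 = x \<in> X\<close> leaves the coset where it is
  and \<open>x\<close> (with the sign of the letter) is written down; any other letter moves the coset and
  nothing is written. Equal elements of \<open>A\<^sub>S\<close> lead to the same coset and to outputs that are
  equal in \<open>A\<^sub>X\<close> (\<open>retraction_respects\<close>). Words over \<open>X\<close> read from the coset \<open>W\<^sub>X\<close> are copied
  verbatim, so \<open>A\<^sub>X\<close> embeds (\<open>parabolic_embeds\<close>). This already settles one direction: if \<open>a\<close> and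
  \<open>b\<close> are joined by an odd path they are conjugate in \<open>A\<^sub>S\<close>, and if they are not joined inside
  \<open>X\<close> then the sum of the exponents of the letters in the odd component of \<open>a\<close> in \<open>X\<close> tells them
  apart in \<open>A\<^sub>X\<close>.

  For the other direction let \<open>p u = v p\<close> in \<open>A\<^sub>S\<close> with \<open>u, v \<in> A\<^sub>X\<close>. Reading both sides from
  \<open>W\<^sub>X\<close> shows that \<open>v\<close> is conjugate in \<open>A\<^sub>X\<close> to the output of \<open>u\<close> read from the coset
  \<open>W\<^sub>X p\<close>. If this coset is \<open>W\<^sub>X\<close>, that output is \<open>u\<close> and the conjugation took place in \<open>A\<^sub>X\<close>.
  Otherwise let \<open>d \<noteq> 1\<close> be the shortest element of the double coset of \<open>p\<close>. All letters written
  while reading words over \<open>X\<close> inside this double coset are of the form \<open>d y d\<^sup>-\<^sup>1\<close> with \<open>y \<in> X\<close>.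
  This is where large type enters: an element of \<open>W\<close> mapping two distinct simple roots to
  simple roots is trivial (\<open>id_if_two_simple_roots_preserved\<close>), so only one letter \<open>x\<close> is ever
  written, and \<open>v\<close> is conjugate in \<open>A\<^sub>X\<close> to a power of \<open>x\<close>. By symmetry \<open>u\<close> is conjugate in
  \<open>A\<^sub>X\<close> to a power of some \<open>x'\<close>. Exponent sums over the odd components of \<open>S\<close> show that the
  exponents agree and that, unless they vanish, \<open>x\<close> and \<open>x'\<close> are joined by an odd path in \<open>S\<close>;
  if this always yields an odd path in \<open>X\<close>, then \<open>u\<close> and \<open>v\<close> are conjugate in \<open>A\<^sub>X\<close>.

  The Coxeter group is used through its geometric representation, where the shortest
  representatives of cosets are recognised by signs of roots. The one fact needed is that
  every root is nonnegative or nonpositive (\<open>root_nonneg_or_nonpos\<close>).\<close>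

section \<open>Alternating words and Chebyshev polynomials\<close>

definition alt :: "'a \<Rightarrow> 'a \<Rightarrow> nat \<Rightarrow> 'a list" where
  "alt s t n = map (\<lambda>i. if even i then s else t) [0..<n]"

lemma alt_0 [simp]: "alt s t 0 = []"
  by (simp add: alt_def)

lemma alt_Suc: "alt s t (Suc n) = alt s t n @ [if even n then s else t]"
  by (simp add: alt_def)

lemma alt_Suc_Cons: "alt s t (Suc n) = s # alt t s n"
  by (induction n) (auto simp: alt_Suc)

lemma alt_add: "alt s t (i + j) = alt s t i @ (if even i then alt s t j else alt t s j)"
  by (induction j) (auto simp: alt_Suc)

lemma length_alt [simp]: "length (alt s t n) = n"
  by (simp add: alt_def)

lemma set_alt: "set (alt s t n) \<subseteq> {s, t}"
  by (auto simp: alt_def)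

lemma alt_in_lists: "s \<in> A \<Longrightarrow> t \<in> A \<Longrightarrow> alt s t n \<in> lists A"
  using set_alt[of s t n] by auto

text \<open>The value at \<open>c / 2\<close> of the Chebyshev polynomial of the second kind of degree \<open>n - 1\<close>: the
  coefficients of roots in a dihedral root system whose Cartan matrix has off-diagonal
  entries \<open>- c\<close>.\<close>

fun cheb :: "real \<Rightarrow> nat \<Rightarrow> real" where
  "cheb c 0 = 0"
| "cheb c (Suc 0) = 1"
| "cheb c (Suc (Suc n)) = c * cheb c (Suc n) - cheb c n"

lemma cheb_2: "cheb 2 n = real n"
  by (induction "2 :: real" n rule: cheb.induct) auto

lemma cheb_cos: "cheb (2 * cos x) n * sin x = sin (real n * x)"
proof (induction "2 * cos x" n rule: cheb.induct)
  case (3 n)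
  have "cheb (2 * cos x) (Suc (Suc n)) * sin x
      = 2 * cos x * (cheb (2 * cos x) (Suc n) * sin x) - cheb (2 * cos x) n * sin x"
    by (simp add: algebra_simps)
  also have "\<dots> = 2 * cos x * sin (real n * x + x) - sin ((real n * x + x) - x)"
    using 3 by (simp add: algebra_simps)
  also have "\<dots> = sin ((real n * x + x) + x)"
    unfolding sin_add[of "real n * x + x" x] sin_diff[of "real n * x + x" x] by simp
  finally show ?case by (simp add: algebra_simps)
qed auto

section \<open>The geometric representation\<close>

definition simple_root :: "'a \<Rightarrow> 'a \<Rightarrow> real" where
  "simple_root s = (\<lambda>t. if t = s then 1 else 0)"

definition nonneg :: "('a \<Rightarrow> real) \<Rightarrow> bool" where
  "nonneg p \<longleftrightarrow> (\<forall>t. 0 \<le> p t)"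

definition nonpos :: "('a \<Rightarrow> real) \<Rightarrow> bool" where
  "nonpos p \<longleftrightarrow> (\<forall>t. p t \<le> 0)"

lemma simple_root_simps [simp]: "simple_root s s = 1" "t \<noteq> s \<Longrightarrow> simple_root s t = 0"
  by (auto simp: simple_root_def)

lemma simple_root_eq_iff [simp]: "simple_root s = simple_root t \<longleftrightarrow> s = t"
  by (metis simple_root_simps zero_neq_one)

lemma nonneg_simple_root [simp]: "nonneg (simple_root s)"
  by (simp add: nonneg_def simple_root_def)

locale coxeter_data =
  fixes S :: "'a set" and m :: "'a \<Rightarrow> 'a \<Rightarrow> enat"
  assumes finite_S: "finite S" and labels: "artin_labels S m"
begin

text \<open>Twice the Tits form on simple roots; a missing edge is treated as \<open>cos 0 = 1\<close>.\<close>

definition cartan :: "'a \<Rightarrow> 'a \<Rightarrow> real" where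
  "cartan s t = (if s = t then 2 else if m s t = \<infinity> then -2
     else - 2 * cos (pi / real (the_enat (m s t))))"

definition coroot :: "'a \<Rightarrow> ('a \<Rightarrow> real) \<Rightarrow> real" where
  "coroot s p = (\<Sum>t\<in>S. cartan s t * p t)"

definition reflect :: "'a \<Rightarrow> ('a \<Rightarrow> real) \<Rightarrow> 'a \<Rightarrow> real" where
  "reflect s p = (\<lambda>t. if t = s then p s - coroot s p else p t)"

definition act :: "'a list \<Rightarrow> ('a \<Rightarrow> real) \<Rightarrow> 'a \<Rightarrow> real" where
  "act w = foldr reflect w"

definition form :: "('a \<Rightarrow> real) \<Rightarrow> ('a \<Rightarrow> real) \<Rightarrow> real" where
  "form p q = (\<Sum>s\<in>S. p s * coroot s q)"

lemma labelsD:
  assumes "s \<in> S" "t \<in> S" "s \<noteq> t"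
  shows "m s t = m t s" "2 \<le> m s t"
  using labels assms by (auto simp: artin_labels_def)

lemma label_finite_ge_2:
  assumes "s \<in> S" "t \<in> S" "s \<noteq> t" "m s t = enat n"
  shows "2 \<le> n"
  using labelsD(2)[OF assms(1-3)] unfolding assms(4) by (simp add: numeral_eq_enat)

lemma cartan_self [simp]: "cartan s s = 2"
  by (simp add: cartan_def)

lemma cartan_sym: "s \<in> S \<Longrightarrow> t \<in> S \<Longrightarrow> cartan s t = cartan t s"
  using labelsD[of s t] by (auto simp: cartan_def)

lemma cheb_nonneg:
  assumes "s \<in> S" "t \<in> S" "s \<noteq> t" "enat k \<le> m s t"
  shows "0 \<le> cheb (- cartan s t) k"
proof (cases "m s t")
  case (enat n)
  then have n: "2 \<le> n" "k \<le> n" and c: "- cartan s t = 2 * cos (pi / real n)"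
    using label_finite_ge_2[OF assms(1-3)] assms by (auto simp: cartan_def)
  have "real k * pi \<le> real n * pi" using n by simp
  then have "0 \<le> sin (real k * (pi / real n))"
    using n by (intro sin_ge_zero) (auto simp: field_simps)
  moreover have "0 < sin (pi / real n)"
    using n by (intro sin_gt_zero) (auto simp: field_simps)
  ultimately show ?thesis
    using cheb_cos[of "pi / real n" k] unfolding c by (metis mult_less_0_iff not_le order.strict_trans)
next
  case infinity
  then show ?thesis using assms by (simp add: cartan_def cheb_2)
qed

lemma cheb_pos:
  assumes "s \<in> S" "t \<in> S" "s \<noteq> t" "0 < k" "m s t = enat n" "k < n"
  shows "0 < cheb (- cartan s t) k"
proof -
  have n: "2 \<le> n" and c: "- cartan s t = 2 * cos (pi / real n)"
    using label_finite_ge_2[OF assms(1-3)] assms by (auto simp: cartan_def)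
  have "real k * pi < real n * pi" using assms by simp
  then have "0 < sin (real k * (pi / real n))"
    using n assms(4) by (intro sin_gt_zero) (auto simp: field_simps)
  moreover have "0 < sin (pi / real n)"
    using n by (intro sin_gt_zero) (auto simp: field_simps)
  ultimately show ?thesis
    using cheb_cos[of "pi / real n" k] unfolding c by (metis mult_pos_pos zero_less_mult_pos2)
qed

lemma cheb_label:
  assumes "s \<in> S" "t \<in> S" "s \<noteq> t" "m s t = enat n"
  shows "cheb (- cartan s t) n = 0" "cheb (- cartan s t) (n - 1) = 1"
    "cheb (- cartan s t) (Suc n) = - 1"
proof -
  let ?x = "pi / real n"
  have n: "2 \<le> n" and c: "- cartan s t = 2 * cos ?x"
    using label_finite_ge_2[OF assms(1-3)] assms by (auto simp: cartan_def)
  have pos: "sin ?x \<noteq> 0"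
    using n sin_gt_zero[of ?x] by (auto simp: field_simps)
  have "cheb (2 * cos ?x) n * sin ?x = sin pi"
    using n cheb_cos[of ?x n] by simp
  then show 0: "cheb (- cartan s t) n = 0" using pos unfolding c by simp
  have "cheb (2 * cos ?x) (n - 1) * sin ?x = sin (pi - ?x)"
    using n cheb_cos[of ?x "n - 1"] by (simp add: field_simps)
  then show 1: "cheb (- cartan s t) (n - 1) = 1" using pos unfolding c by simp
  show "cheb (- cartan s t) (Suc n) = - 1"
    using 0 1 n by (cases n) auto
qed

lemma cartan_gt_minus_2:
  assumes "s \<in> S" "t \<in> S" "s \<noteq> t" "m s t = enat n"
  shows "cartan s t \<le> 0" "- 2 < cartan s t"
proof -
  have n: "2 \<le> n" and c: "cartan s t = - 2 * cos (pi / real n)"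
    using label_finite_ge_2[OF assms(1-3)] assms by (auto simp: cartan_def)
  have "cos (pi / real n) < cos 0"
    using n by (intro cos_monotone_0_pi) (auto simp: field_simps)
  then show "- 2 < cartan s t" using c by simp
  have "0 \<le> pi / real n" "pi / real n \<le> pi / 2"
    using n by (auto simp: field_simps)
  then have "0 \<le> cos (pi / real n)"
    using pi_gt_zero by (intro cos_ge_zero) linarith+
  then show "cartan s t \<le> 0" using c by simp
qed

lemma label_eq_if_cartan_eq:
  assumes st: "s \<in> S" "t \<in> S" "s \<noteq> t" "m s t = enat n"
    and xy: "x \<in> S" "y \<in> S" "x \<noteq> y" and eq: "cartan s t = cartan x y"
  shows "m x y = enat n"
proof (cases "m x y")
  case (enat k)
  have in_pi: "0 \<le> pi / real j \<and> pi / real j \<le> pi" if "2 \<le> j" for j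
    using that by (simp add: field_simps)
  have k: "2 \<le> k" using label_finite_ge_2[OF xy enat] .
  have n: "2 \<le> n" using label_finite_ge_2[OF st] .
  have "cos (pi / real k) = cos (pi / real n)"
    using eq st xy enat by (simp add: cartan_def)
  then have "pi / real k = pi / real n"
    using in_pi[OF n] in_pi[OF k] cos_inj_pi by blast
  then have "real k = real n" using n k by (simp add: frac_eq_eq)
  then show ?thesis using enat by simp
next
  case infinity
  then show ?thesis using cartan_gt_minus_2[OF st] eq xy by (simp add: cartan_def)
qed

lemma coroot_simple_root [simp]: "t \<in> S \<Longrightarrow> coroot s (simple_root t) = cartan s t"
  using finite_S by (simp add: coroot_def simple_root_def if_distrib cong: if_cong)

lemma coroot_lin: "coroot s (\<lambda>t. a * p t + b * q t) = a * coroot s p + b * coroot s q"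
  by (simp add: coroot_def sum.distrib sum_distrib_left algebra_simps)

lemma reflect_eq: "reflect s p = (\<lambda>t. p t - coroot s p * simple_root s t)"
  by (auto simp: reflect_def simple_root_def)

lemma coroot_reflect: "s \<in> S \<Longrightarrow> coroot u (reflect s p) = coroot u p - coroot s p * cartan u s"
  using coroot_lin[of u 1 p "- coroot s p" "simple_root s"] by (simp add: reflect_eq)

lemma reflect_simple_root: "t \<in> S \<Longrightarrow> reflect s (simple_root t) = (\<lambda>u. simple_root t u - cartan s t * simple_root s u)"
  by (simp add: reflect_eq)

lemma reflect_self: "s \<in> S \<Longrightarrow> reflect s (simple_root s) = (\<lambda>u. - simple_root s u)"
  by (simp add: reflect_eq)

lemma reflect_lin: "reflect s (\<lambda>t. a * p t + b * q t) = (\<lambda>t. a * reflect s p t + b * reflect s q t)"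
  by (auto simp: reflect_eq coroot_lin algebra_simps)

lemma reflect_reflect [simp]: "s \<in> S \<Longrightarrow> reflect s (reflect s p) = p"
  unfolding reflect_eq[of s "reflect s p"] by (simp add: coroot_reflect) (simp add: reflect_eq)

lemma act_simps [simp]:
  "act [] p = p" "act (s # w) p = reflect s (act w p)" "act (v @ w) p = act v (act w p)"
  by (simp_all add: act_def)

lemma act_lin: "act w (\<lambda>t. a * p t + b * q t) = (\<lambda>t. a * act w p t + b * act w q t)"
  by (induction w) (auto simp: reflect_lin)

lemma act_zero: "act w (\<lambda>t. 0) = (\<lambda>t. 0)"
  using act_lin[of w 0 "\<lambda>t. 0" 0 "\<lambda>t. 0"] by simp

lemma act_uminus: "act w (\<lambda>t. - p t) = (\<lambda>t. - act w p t)"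
  using act_lin[of w "-1" p 0 p] by simp

lemma act_sum: "finite F \<Longrightarrow> act w (\<lambda>t. \<Sum>z\<in>F. a z * f z t) = (\<lambda>t. \<Sum>z\<in>F. a z * act w (f z) t)"
proof (induction F rule: finite_induct)
  case empty
  then show ?case by (simp add: act_zero)
next
  case (insert z F)
  then show ?case
    using act_lin[of w "a z" "f z" 1 "\<lambda>t. \<Sum>z\<in>F. a z * f z t"] by simp
qed

text \<open>Elements of the group are linear, so a root can be pushed through one by expanding it into
  simple roots.\<close>

lemma act_expand:
  assumes "finite K" "\<And>t. t \<notin> K \<Longrightarrow> p t = 0"
  shows "act w p = (\<lambda>t. \<Sum>z\<in>K. p z * act w (simple_root z) t)"
proof -
  have "p = (\<lambda>t. \<Sum>z\<in>K. p z * simple_root z t)"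
    using assms by (auto simp: fun_eq_iff simple_root_def if_distrib cong: if_cong)
  then have "act w p = act w (\<lambda>t. \<Sum>z\<in>K. p z * simple_root z t)" by simp
  then show ?thesis by (simp add: act_sum assms(1))
qed

lemma act_outside: "w \<in> lists K \<Longrightarrow> t \<notin> K \<Longrightarrow> act w p t = p t"
  by (induction w) (auto simp: reflect_def)

lemma act_rev [simp]: "w \<in> lists S \<Longrightarrow> act (rev w) (act w p) = p"
  by (induction w arbitrary: p) auto

lemma act_rev' [simp]: "w \<in> lists S \<Longrightarrow> act w (act (rev w) p) = p"
  using act_rev[of "rev w" p] by (simp add: in_lists_conv_set)

lemma form_lin1: "form (\<lambda>t. a * p t + b * q t) r = a * form p r + b * form q r"
  by (simp add: form_def sum.distrib sum_distrib_left algebra_simps)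

lemma form_lin2: "form r (\<lambda>t. a * p t + b * q t) = a * form r p + b * form r q"
  by (simp add: form_def coroot_lin sum.distrib sum_distrib_left algebra_simps)

lemma form_sym: "form p q = form q p"
proof -
  have "form p q = (\<Sum>s\<in>S. \<Sum>t\<in>S. p s * (cartan s t * q t))"
    by (simp add: form_def coroot_def sum_distrib_left)
  also have "\<dots> = (\<Sum>t\<in>S. \<Sum>s\<in>S. p s * (cartan s t * q t))"
    by (rule sum.swap)
  also have "\<dots> = (\<Sum>t\<in>S. \<Sum>s\<in>S. q t * (cartan t s * p s))"
    by (intro sum.cong) (auto simp: cartan_sym)
  finally show ?thesis by (simp add: form_def coroot_def sum_distrib_left)
qed

lemma form_simple_root [simp]: "s \<in> S \<Longrightarrow> form (simple_root s) q = coroot s q"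
  using finite_S by (simp add: form_def simple_root_def of_bool_def[symmetric])

lemma form_simple_root_right: "s \<in> S \<Longrightarrow> form q (simple_root s) = coroot s q"
  by (subst form_sym) simp

lemma form_reflect: "s \<in> S \<Longrightarrow> form (reflect s p) (reflect s q) = form p q"
  using form_lin1[of 1 p "- coroot s p" "simple_root s" "reflect s q"]
    form_lin2[of p 1 q "- coroot s q" "simple_root s"]
  by (simp add: reflect_eq[of s p] coroot_reflect) (simp add: reflect_eq form_simple_root_right algebra_simps)

lemma form_act: "w \<in> lists S \<Longrightarrow> form (act w p) (act w q) = form p q"
  by (induction w) (auto simp: form_reflect)

text \<open>Under alternating reflections the pair of coroot values obeys the Chebyshev recurrence.
  The two claims are proved together because the recurrence has order two.\<close>

lemma coroot_alt:
  assumes st: "s \<in> S" "t \<in> S"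
  defines "c \<equiv> - cartan s t"
  defines "l \<equiv> \<lambda>k. if even k then s else t"
  shows "coroot (l k) (act (rev (alt s t k)) p) = cheb c (Suc k) * coroot s p + cheb c k * coroot t p"
    and "coroot (l (Suc k)) (act (rev (alt s t (Suc k))) p)
      = cheb c (Suc (Suc k)) * coroot s p + cheb c (Suc k) * coroot t p"
proof (induction k)
  case 0
  { case 1 show ?case by (simp add: l_def) }
  { case 2 show ?case using st by (simp add: l_def alt_Suc coroot_reflect c_def cartan_sym) }
next
  case (Suc k)
  { case 1 show ?case using Suc by simp }
  { case 2
    have ct: "cartan (l k) (l (Suc k)) = - c" "l (Suc (Suc k)) = l k" "l k \<in> S" "l (Suc k) \<in> S"
      using st by (auto simp: l_def c_def cartan_sym)
    have alt: "alt s t (Suc k) = alt s t k @ [l k]" "alt s t (Suc (Suc k)) = alt s t (Suc k) @ [l (Suc k)]"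
      by (simp_all add: alt_Suc l_def)
    have "coroot (l k) (act (rev (alt s t (Suc k))) p) = - coroot (l k) (act (rev (alt s t k)) p)"
      using ct by (simp add: alt coroot_reflect)
    then have "coroot (l (Suc (Suc k))) (act (rev (alt s t (Suc (Suc k)))) p)
        = - coroot (l k) (act (rev (alt s t k)) p) + c * coroot (l (Suc k)) (act (rev (alt s t (Suc k))) p)"
      using ct by (simp add: alt(2) coroot_reflect)
    also have "\<dots> = - (cheb c (Suc k) * coroot s p + cheb c k * coroot t p)
        + c * (cheb c (Suc (Suc k)) * coroot s p + cheb c (Suc k) * coroot t p)"
      using Suc by simp
    finally show ?case by (simp add: algebra_simps) }
qed

lemma coroot_alt_label:
  assumes "s \<in> S" "t \<in> S" "s \<noteq> t" "m s t = enat n"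
  shows "coroot (if even n then s else t) (act (rev (alt s t n)) p) = - coroot s p"
    and "coroot (if even n then t else s) (act (rev (alt s t n)) p) = - coroot t p"
proof -
  obtain k where k: "n = Suc k" using label_finite_ge_2[OF assms] by (cases n) auto
  show "coroot (if even n then s else t) (act (rev (alt s t n)) p) = - coroot s p"
    using coroot_alt(1)[OF assms(1,2), of n p] cheb_label[OF assms] by simp
  show "coroot (if even n then t else s) (act (rev (alt s t n)) p) = - coroot t p"
    using coroot_alt(1)[OF assms(1,2), of k p] cheb_label[OF assms] assms(1,2)
    by (auto simp: k alt_Suc coroot_reflect)
qed

text \<open>Both sides differ from \<open>p\<close> by a combination of the two simple roots only, and by
  \<open>coroot_alt_label\<close> both have the same coroot values. The two combinations then agree because
  the Gram matrix of two simple roots with finite label is nondegenerate.\<close>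

lemma braid:
  assumes "s \<in> S" "t \<in> S" "s \<noteq> t" "m s t = enat n"
  shows "act (rev (alt s t n)) = act (rev (alt t s n))"
proof
  fix p
  let ?p = "act (rev (alt s t n)) p" and ?q = "act (rev (alt t s n)) p"
  have ts: "m t s = enat n" using labelsD[OF assms(1-3)] assms(4) by simp
  have lists: "rev (alt s t n) \<in> lists {s, t}" "rev (alt t s n) \<in> lists {s, t}"
    using alt_in_lists[of s "{s,t}" t n] alt_in_lists[of t "{s,t}" s n] by (auto simp: in_lists_conv_set)
  define d where "d = (\<lambda>u. ?p u - ?q u)"
  have d: "d u = 0" if "u \<notin> {s, t}" for u
    using lists[THEN act_outside[OF _ that]] by (simp add: d_def)
  have "coroot u ?p = coroot u ?q" if "u \<in> {s, t}" for u
    using that coroot_alt_label[OF assms, of p]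
      coroot_alt_label[OF assms(2,1) assms(3)[symmetric] ts, of p] by (auto split: if_splits)
  then have cd: "coroot u d = 0" if "u \<in> {s, t}" for u
    using that coroot_lin[of u 1 ?p "-1" ?q] by (simp add: d_def)
  have "d = (\<lambda>u. d s * simple_root s u + d t * simple_root t u)"
    using d assms(3) by (auto simp: fun_eq_iff simple_root_def)
  then have co: "coroot u d = d s * cartan u s + d t * cartan u t" for u
    using coroot_lin[of u "d s" "simple_root s" "d t" "simple_root t"] assms(1,2) by simp
  have eqs: "2 * d s + cartan s t * d t = 0" "cartan s t * d s + 2 * d t = 0"
    using cd[of s] cd[of t] co[of s] co[of t] cartan_sym[OF assms(1,2)] by (simp_all add: mult.commute)
  have "(4 - cartan s t * cartan s t) * d s
      = 2 * (2 * d s + cartan s t * d t) - cartan s t * (cartan s t * d s + 2 * d t)"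
    "(4 - cartan s t * cartan s t) * d t
      = 2 * (cartan s t * d s + 2 * d t) - cartan s t * (2 * d s + cartan s t * d t)"
    by (simp_all add: algebra_simps)
  then have prod: "(4 - cartan s t * cartan s t) * d s = 0" "(4 - cartan s t * cartan s t) * d t = 0"
    unfolding eqs by simp_all
  have "\<bar>cartan s t\<bar> < 2" using cartan_gt_minus_2[OF assms] by simp
  then have "4 - cartan s t * cartan s t \<noteq> 0"
    using abs_square_less_1[of "cartan s t / 2"] by (simp add: power2_eq_square)
  then have "d s = 0" "d t = 0" using prod by auto
  then have "d u = 0" for u using d by (cases "u \<in> {s, t}") auto
  then show "?p = ?q" by (auto simp: d_def fun_eq_iff)
qed

lemma act_alt_simple_root:
  assumes "s \<in> S" "t \<in> S"
  defines "l \<equiv> \<lambda>k. if even k then t else s"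
  shows "act (rev (alt t s k)) (simple_root s)
    = (\<lambda>u. cheb (- cartan s t) (Suc k) * simple_root (l (Suc k)) u
          + cheb (- cartan s t) k * simple_root (l k) u)"
proof (induction k)
  case 0
  then show ?case by (simp add: l_def)
next
  case (Suc k)
  have l: "l k \<in> S" "l (Suc k) \<in> S" "l (Suc (Suc k)) = l k" "cartan (l k) (l (Suc k)) = cartan s t"
    using assms(1,2) by (auto simp: l_def cartan_sym)
  have "act (rev (alt t s (Suc k))) (simple_root s) = reflect (l k) (act (rev (alt t s k)) (simple_root s))"
    by (simp add: alt_Suc l_def)
  also have "\<dots> = (\<lambda>u. cheb (- cartan s t) (Suc k) * reflect (l k) (simple_root (l (Suc k))) u
          + cheb (- cartan s t) k * reflect (l k) (simple_root (l k)) u)"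
    by (simp add: Suc reflect_lin)
  also have "\<dots> = (\<lambda>u. cheb (- cartan s t) (Suc (Suc k)) * simple_root (l (Suc (Suc k))) u
          + cheb (- cartan s t) (Suc k) * simple_root (l (Suc k)) u)"
    using l by (auto simp: reflect_simple_root reflect_self algebra_simps)
  finally show ?case .
qed

section \<open>Roots are nonnegative or nonpositive\<close>

definition len :: "(('a \<Rightarrow> real) \<Rightarrow> 'a \<Rightarrow> real) \<Rightarrow> nat" where
  "len g = (LEAST n. \<exists>w\<in>lists S. length w = n \<and> act w = g)"

lemma len_le: "w \<in> lists S \<Longrightarrow> len (act w) \<le> length w"
  unfolding len_def by (rule Least_le) auto

lemma reduced_word:
  assumes "w \<in> lists S"
  obtains r where "r \<in> lists S" "act r = act w" "length r = len (act w)"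
proof -
  have "\<exists>r\<in>lists S. length r = len (act w) \<and> act r = act w"
    unfolding len_def by (rule LeastI[of _ "length w"]) (use assms in auto)
  then show thesis using that by auto
qed

lemma len_append:
  assumes "v \<in> lists S" "w \<in> lists S"
  shows "len (act (v @ w)) \<le> len (act v) + length w"
proof -
  obtain r where r: "r \<in> lists S" "act r = act v" "length r = len (act v)"
    using reduced_word[OF assms(1)] .
  have "act (v @ w) = act (r @ w)" using r(2) by (auto simp: fun_eq_iff)
  then show ?thesis using len_le[of "r @ w"] r assms by simp
qed

text \<open>Tits's argument by induction on length. Let \<open>t\<close> be the last letter of a reduced word of \<open>w\<close>.
  Splitting off from the right as long an alternating word in \<open>s\<close> and \<open>t\<close> as possible leaves a
  shorter element \<open>v\<close> that neither \<open>s\<close> nor \<open>t\<close> shortens, to which the induction hypothesis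
  applies. The split-off word has fewer than \<open>m s t\<close> letters, hence maps \<open>s\<close> to a nonnegative
  combination of the two simple roots.\<close>

lemma ascent_nonneg:
  assumes "w \<in> lists S" "s \<in> S" "len (act w) \<le> len (act (w @ [s]))"
  shows "nonneg (act w (simple_root s))"
  using assms
proof (induction "len (act w)" arbitrary: w s rule: less_induct)
  case (less w s)
  obtain r where r: "r \<in> lists S" "act r = act w" "length r = len (act w)"
    using reduced_word[OF less.prems(1)] .
  show ?case
  proof (cases r rule: rev_cases)
    case Nil
    then show ?thesis using r(2) by (metis act_simps(1) nonneg_simple_root)
  next
    case (snoc r' t)
    have mem: "s \<in> S" "t \<in> S" "r' \<in> lists S" using less.prems r(1) snoc by auto
    have "t \<noteq> s"
    proof
      assume "t = s"
      then have "act (w @ [s]) = act r'" using r(2)[symmetric] snoc mem by (auto simp: fun_eq_iff)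
      then show False using len_le[of r'] less.prems(3) mem r(3) snoc by simp
    qed
    \<comment> \<open>The possible lengths of an alternating tail of \<open>w\<close>; the longest one is taken.\<close>
    define A where "A = {k. \<exists>v\<in>lists S. act (v @ rev (alt t s k)) = act w \<and> len (act v) + k = len (act w)}"
    have alts: "alt t s k \<in> lists S" "rev (alt t s k) \<in> lists S" for k
      using alt_in_lists[OF mem(2,1)] by (auto simp: in_lists_conv_set)
    have "len (act r') + 1 = len (act w)"
      using len_le[of r'] len_append[of r' "[t]"] r snoc mem by simp
    moreover have "alt t s 1 = [t]" by (simp add: alt_def)
    ultimately have A1: "1 \<in> A"
      unfolding A_def using r(2) mem(3) snoc by (intro CollectI bexI[of _ r']) simp_all
    have fin: "finite A"
      by (rule finite_subset[of _ "{..len (act w)}"]) (auto simp: A_def)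
    define k where "k = Max A"
    have "k \<in> A" and kmax: "\<And>j. j \<in> A \<Longrightarrow> j \<le> k"
      unfolding k_def using Max_in[OF fin] Max_ge[OF fin] A1 by auto
    then obtain v where v: "v \<in> lists S" "act (v @ rev (alt t s k)) = act w" "len (act v) + k = len (act w)"
      by (auto simp: A_def)
    obtain k' where k': "k = Suc k'" using kmax[OF A1] by (cases k) auto
    \<comment> \<open>\<open>x\<close> would prolong the alternating tail on its left, \<open>y\<close> is its first letter.\<close>
    define x y where "x = (if even k then t else s)" and "y = (if even k then s else t)"
    have xy: "x \<in> S" "y \<in> S" "{x, y} = {s, t}" using mem by (auto simp: x_def y_def)
    have "len (act v) \<le> len (act (v @ [x]))"
    proof (rule ccontr)
      assume neg: "\<not> ?thesis"
      have eq: "act ((v @ [x]) @ rev (alt t s (Suc k))) = act w"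
        using v(2) xy by (auto simp: fun_eq_iff alt_Suc x_def)
      have "len (act w) \<le> len (act (v @ [x])) + Suc k"
        using len_append[of "v @ [x]" "rev (alt t s (Suc k))"] v(1) xy(1) alts eq by simp
      then have "Suc k \<in> A"
        using neg v eq xy by (auto simp: A_def intro!: bexI[of _ "v @ [x]"])
      then show False using kmax by force
    qed
    moreover have "len (act v) \<le> len (act (v @ [y]))"
    proof (rule ccontr)
      assume neg: "\<not> ?thesis"
      have eq: "act ((v @ [y]) @ rev (alt t s k')) = act w"
        using v(2) by (auto simp: fun_eq_iff alt_Suc y_def k')
      have "len (act w) \<le> len (act (v @ [y])) + k'"
        using len_append[of "v @ [y]" "rev (alt t s k')"] v(1) xy(2) alts eq by simp
      then show False using neg v(3) k' by simp
    qed
    ultimately have vst: "len (act v) \<le> len (act (v @ [s]))" "len (act v) \<le> len (act (v @ [t]))"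
      using xy(3) by (auto simp: doubleton_eq_iff)
    have "len (act v) < len (act w)" using v(3) k' by simp
    then have pos: "nonneg (act v (simple_root s))" "nonneg (act v (simple_root t))"
      using less.hyps[OF _ v(1)] vst mem by auto
    \<comment> \<open>A tail with at least \<open>m s t\<close> letters could be rewritten to end in \<open>s\<close>, and \<open>s\<close> would shorten \<open>w\<close>.\<close>
    have "enat k < m s t"
    proof (rule ccontr)
      assume "\<not> ?thesis"
      then obtain n where n: "m s t = enat n" "n \<le> k" by (cases "m s t") auto
      obtain n' where n': "n = Suc n'" using label_finite_ge_2[OF mem(1,2) _ n(1)] \<open>t \<noteq> s\<close> by (cases n) auto
      define z where "z = rev (drop n (alt t s k))"
      have "alt t s k = alt t s n @ drop n (alt t s k)"
        using alt_add[of t s n "k - n"] n(2) by simp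
      then have z: "rev (alt t s k) = z @ rev (alt t s n)" unfolding z_def by (metis rev_append)
      have zS: "z \<in> lists S" "length z = k - n"
        using alts[of k] unfolding z_def by (auto simp: in_lists_conv_set dest: in_set_dropD)
      have "act (w @ [s]) p = act (v @ z @ rev (alt t s n') ) p" for p
      proof -
        have "act (w @ [s]) p = act v (act z (act (rev (alt t s n)) (reflect s p)))"
          using v(2)[symmetric] z by simp
        also have "act (rev (alt t s n)) = act (rev (alt s t n))"
          using braid[OF mem(1,2) _ n(1)] \<open>t \<noteq> s\<close> by auto
        also have "act (rev (alt s t n)) (reflect s p) = act (rev (alt t s n')) p"
          using mem by (simp add: n' alt_Suc_Cons)
        finally show ?thesis by simp
      qed
      then have "act (w @ [s]) = act (v @ z @ rev (alt t s n'))" by blast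
      then have "len (act (w @ [s])) \<le> len (act v) + (k - n + n')"
        using len_append[of v "z @ rev (alt t s n')"] v(1) zS alts by simp
      then show False using less.prems(3) v(3) n n' by simp
    qed
    then have cheb: "0 \<le> cheb (- cartan s t) k" "0 \<le> cheb (- cartan s t) (Suc k)"
      using cheb_nonneg[OF mem(1,2)] \<open>t \<noteq> s\<close> by (auto simp: Suc_ile_eq)
    have "act w (simple_root s) = act v (act (rev (alt t s k)) (simple_root s))"
      using v(2)[symmetric] by simp
    then show ?thesis
      using pos cheb by (auto simp: act_alt_simple_root[OF mem(1,2)] act_lin nonneg_def)
  qed
qed

theorem root_nonneg_or_nonpos:
  assumes "w \<in> lists S" "s \<in> S"
  shows "nonneg (act w (simple_root s)) \<or> nonpos (act w (simple_root s))"
proof (cases "len (act w) \<le> len (act (w @ [s]))")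
  case True
  then show ?thesis using ascent_nonneg assms by blast
next
  case False
  have "act ((w @ [s]) @ [s]) = act w" using assms by (auto simp: fun_eq_iff)
  then have "nonneg (act (w @ [s]) (simple_root s))"
    using False assms ascent_nonneg[of "w @ [s]" s] by simp
  then show ?thesis
    using assms by (auto simp: reflect_self act_uminus nonneg_def nonpos_def)
qed

end

section \<open>Signs of roots in the Coxeter group\<close>

abbreviation ginv :: "('b \<Rightarrow> 'b) \<Rightarrow> 'b \<Rightarrow> 'b" where
  "ginv g \<equiv> inv_into UNIV g"

context coxeter_data
begin

definition W :: "(('a \<Rightarrow> real) \<Rightarrow> 'a \<Rightarrow> real) set" where
  "W = act ` lists S"

lemma W_obtain_word:
  assumes "g \<in> W"
  obtains w where "w \<in> lists S" "g = act w"
  using assms unfolding W_def by blast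

lemma act_Nil_id: "act [] = id"
  by auto

lemma id_in_W: "id \<in> W"
  unfolding W_def by (metis act_Nil_id image_eqI lists.Nil)

lemma reflect_in_W: "g \<in> W \<Longrightarrow> s \<in> S \<Longrightarrow> reflect s \<circ> g \<in> W"
proof -
  assume "g \<in> W" "s \<in> S"
  then obtain w where "w \<in> lists S" "g = act w" by (auto simp: W_def)
  moreover have "reflect s \<circ> act w = act (s # w)" by auto
  ultimately show ?thesis using \<open>s \<in> S\<close> by (auto simp: W_def)
qed

lemma inv_act: "w \<in> lists S \<Longrightarrow> ginv (act w) = act (rev w)"
  by (rule inv_equality) auto

lemma W_inv [simp]:
  assumes "g \<in> W"
  shows "ginv g (g p) = p" "g (ginv g p) = p"
  using assms by (elim W_obtain_word; simp add: inv_act)+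

lemma inv_in_W: "g \<in> W \<Longrightarrow> ginv g \<in> W"
  unfolding W_def by (force simp: inv_act in_lists_conv_set)

lemma W_eq_iff: "g \<in> W \<Longrightarrow> g p = g q \<longleftrightarrow> p = q"
  by (metis W_inv(1))

lemma W_root: "g \<in> W \<Longrightarrow> s \<in> S \<Longrightarrow> nonneg (g (simple_root s)) \<or> nonpos (g (simple_root s))"
  by (elim W_obtain_word) (simp add: root_nonneg_or_nonpos)

lemma not_nonneg_uminus_simple_root: "\<not> nonneg (\<lambda>u. - simple_root s u)"
  by (auto simp: nonneg_def intro!: exI[of _ s])

lemma len_rev_le: "w \<in> lists S \<Longrightarrow> len (act (rev w)) \<le> len (act w)"
proof -
  assume w: "w \<in> lists S"
  obtain r where r: "r \<in> lists S" "act r = act w" "length r = len (act w)"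
    using reduced_word[OF w] .
  have "act (rev w) = act (rev r)"
    using inv_act[OF w] inv_act[OF r(1)] r(2) by simp
  then show ?thesis using len_le[of "rev r"] r by (simp add: in_lists_conv_set)
qed

lemma descent_len:
  assumes "w \<in> lists S" "s \<in> S" "\<not> nonneg (act w (simple_root s))"
  shows "len (act (w @ [s])) < len (act w)"
  using ascent_nonneg[OF assms(1,2)] assms(3) by force

lemma left_descent_len:
  assumes "g \<in> W" "s \<in> S" "\<not> nonneg (ginv g (simple_root s))"
  shows "len (reflect s \<circ> g) < len g"
proof -
  obtain w where w: "w \<in> lists S" "g = act w" using assms by (auto simp: W_def)
  have "len (act (rev w @ [s])) < len (act (rev w))"
    using assms w by (intro descent_len) (auto simp: inv_act in_lists_conv_set)
  moreover have "len (act (rev w)) \<le> len (act w)"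
    using w by (rule_tac len_rev_le)
  moreover have "len (act (rev (rev w @ [s]))) \<le> len (act (rev w @ [s]))"
    using w assms(2) by (intro len_rev_le) (auto simp: in_lists_conv_set)
  moreover have "reflect s \<circ> g = act (rev (rev w @ [s]))" using w by auto
  ultimately show ?thesis using w(2) by simp
qed

lemma form_W: "g \<in> W \<Longrightarrow> form (g p) (g q) = form p q"
  by (elim W_obtain_word) (simp add: form_act)

text \<open>All roots have the same norm, so the only nonnegative root on the line of a simple root is
  that simple root.\<close>

lemma root_on_line:
  assumes "g \<in> W" "s \<in> S" "x \<in> S" "nonneg (g (simple_root s))"
    and supp: "\<And>t. t \<noteq> x \<Longrightarrow> g (simple_root s) t = 0"
  shows "g (simple_root s) = simple_root x"
proof -
  define c where "c = g (simple_root s) x"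
  have eq: "g (simple_root s) = (\<lambda>t. c * simple_root x t + 0 * simple_root x t)"
    using supp by (auto simp: c_def fun_eq_iff simple_root_def)
  have "2 = form (g (simple_root s)) (g (simple_root s))"
    using assms by (simp add: form_W)
  also have "\<dots> = 2 * c ^ 2"
    using assms(3) unfolding eq form_lin1 form_lin2 by (simp add: power2_eq_square)
  finally have "c ^ 2 = 1" by simp
  moreover have "0 \<le> c" using assms(4) by (auto simp: c_def nonneg_def)
  ultimately have "c = 1" by (simp add: power2_eq_1_iff)
  then show ?thesis using eq by simp
qed

text \<open>A simple reflection changes a single coordinate, so it can make a positive root negative only
  if that root lies on the line of its own simple root.\<close>

lemma reflect_positive_root:
  assumes "g \<in> W" "s \<in> S" "z \<in> S" "nonneg (g (simple_root s))" "g (simple_root s) \<noteq> simple_root z"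
  shows "nonneg (reflect z (g (simple_root s)))"
proof (rule ccontr)
  assume "\<not> ?thesis"
  then have np: "nonpos (reflect z (g (simple_root s)))"
    using W_root[OF reflect_in_W[OF assms(1,3)] assms(2)] by simp
  have "g (simple_root s) t = 0" if "t \<noteq> z" for t
    using np assms(4) that by (auto simp: nonneg_def nonpos_def reflect_def intro: antisym elim!: allE[of _ t])
  then show False using root_on_line[OF assms(1,2,3,4)] assms(5) by blast
qed

text \<open>Applying the inverse of \<open>g\<close> writes the simple root of \<open>x\<close> as a nonnegative combination of
  positive roots. All of these must then be multiples of it, hence equal to it, so the
  combination has a single term.\<close>

lemma positive_on_span_simple:
  assumes g: "g \<in> W" and K: "K \<subseteq> S" and pos: "\<And>z. z \<in> K \<Longrightarrow> nonneg (ginv g (simple_root z))"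
    and x: "x \<in> S" "nonneg (g (simple_root x))" and supp: "\<And>t. t \<notin> K \<Longrightarrow> g (simple_root x) t = 0"
  shows "\<exists>z\<in>K. g (simple_root x) = simple_root z"
proof -
  let ?a = "g (simple_root x)"
  have fin: "finite K" using K finite_S finite_subset by blast
  obtain w where w: "w \<in> lists S" "ginv g = act w" using inv_in_W[OF g] by (auto simp: W_def)
  have "simple_root x = ginv g ?a" using g by simp
  also have "\<dots> = (\<lambda>t. \<Sum>z\<in>K. ?a z * ginv g (simple_root z) t)"
    unfolding w(2) using act_expand[OF fin supp] by simp
  finally have eq: "simple_root x t = (\<Sum>z\<in>K. ?a z * ginv g (simple_root z) t)" for t
    by (rule fun_cong)
  have a0: "0 \<le> ?a z" for z using x(2) by (simp add: nonneg_def)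
  have terms: "0 \<le> ?a z * ginv g (simple_root z) t" if "z \<in> K" for z t
    using a0 pos[OF that] by (simp add: nonneg_def)
  have "\<exists>z\<in>K. ?a z \<noteq> 0"
  proof (rule ccontr)
    assume "\<not> ?thesis"
    then show False using eq[of x] by simp
  qed
  then obtain z where z: "z \<in> K" "?a z \<noteq> 0" by blast
  have "ginv g (simple_root z) t = 0" if "t \<noteq> x" for t
  proof -
    have "(\<Sum>z\<in>K. ?a z * ginv g (simple_root z) t) = 0" using eq[of t] that by simp
    then have "?a z * ginv g (simple_root z) t = 0"
      using sum_nonneg_eq_0_iff[OF fin, of "\<lambda>z. ?a z * ginv g (simple_root z) t"] terms z(1) by simp
    then show ?thesis using z(2) by simp
  qed
  then have "ginv g (simple_root z) = simple_root x"
    using root_on_line[OF inv_in_W[OF g], of z x] z(1) K x(1) pos by blast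
  then have "?a = simple_root z" using W_inv(2)[OF g] by metis
  then show ?thesis using z(1) by blast
qed

lemma cartan_le_minus_1:
  assumes "large_type S m" "s \<in> S" "t \<in> S" "s \<noteq> t"
  shows "cartan s t \<le> - 1"
proof (cases "m s t")
  case (enat n)
  have "3 \<le> m s t" using assms by (simp add: large_type_def)
  then have n: "3 \<le> n" unfolding enat by (simp add: numeral_eq_enat)
  have "cos (pi / 3) \<le> cos (pi / real n)"
    using n by (intro cos_monotone_0_pi_le) (auto simp: field_simps)
  then show ?thesis using enat assms(4) by (simp add: cartan_def cos_60)
next
  case infinity
  then show ?thesis using assms by (simp add: cartan_def)
qed

text \<open>If \<open>g \<noteq> 1\<close>, some simple root \<open>s\<close> is mapped by \<open>g\<close> to a negative root, which is not in the
  span of \<open>x'\<close> and \<open>y'\<close>. Hence \<open>g\<close> makes negative every positive root in the span of \<open>s\<close>, \<open>x\<close>,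
  \<open>y\<close> with positive coefficient at \<open>s\<close>. In large type these three simple roots generate an
  infinite root system: along the word \<open>s x y s x y ...\<close> the successive roots only grow. So each
  further letter of this word shortens \<open>g\<close>, which cannot go on forever.\<close>

lemma id_if_two_simple_roots_preserved:
  assumes large: "large_type S m" and g: "g \<in> W"
    and mem: "x \<in> S" "y \<in> S" "x' \<in> S" "y' \<in> S" "x \<noteq> y"
    and gx: "g (simple_root x) = simple_root x'" and gy: "g (simple_root y) = simple_root y'"
  shows "g = id"
proof (rule ccontr)
  assume "g \<noteq> id"
  obtain w where w: "w \<in> lists S" "g = act w" using g by (auto simp: W_def)
  obtain r where r: "r \<in> lists S" "act r = act w" "length r = len (act w)"
    using reduced_word[OF w(1)] .
  have "r \<noteq> []" using \<open>g \<noteq> id\<close> r w by (metis act_Nil_id)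
  then obtain r' s where rs: "r = r' @ [s]" by (metis rev_exhaust)
  then have s: "s \<in> S" "r' \<in> lists S" using r by auto
  have ws: "act (w @ [s]) = act r'" using r(2)[symmetric] rs s by (auto simp: fun_eq_iff)
  have "\<not> nonneg (act w (simple_root s))"
  proof
    assume pos: "nonneg (act w (simple_root s))"
    have "\<not> nonneg (act (w @ [s]) (simple_root s))"
    proof
      assume "nonneg (act (w @ [s]) (simple_root s))"
      then have "nonneg (\<lambda>u. - act w (simple_root s) u)"
        using s by (simp add: reflect_self act_uminus)
      then have "act w (simple_root s) = (\<lambda>u. 0)"
        using pos by (auto simp: nonneg_def fun_eq_iff intro: antisym)
      then have "simple_root s = act (rev w) (\<lambda>u. 0)" using act_rev[OF w(1)] by metis
      then show False by (simp add: act_zero fun_eq_iff) (metis simple_root_simps(1) zero_neq_one)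
    qed
    then have "len (act ((w @ [s]) @ [s])) < len (act (w @ [s]))"
      using w s by (intro descent_len) auto
    moreover have "act ((w @ [s]) @ [s]) = act w" using s by auto
    ultimately show False using ws len_le[OF s(2)] r(3) rs by simp
  qed
  then have neg: "nonpos (act w (simple_root s))" and sxy: "s \<noteq> x" "s \<noteq> y"
    using root_nonneg_or_nonpos[OF w(1) s(1)] gx gy w(2) by auto
  \<comment> \<open>Otherwise injectivity would put the simple root of \<open>s\<close> into the span of those of \<open>x\<close> and \<open>y\<close>.\<close>
  have "\<exists>z. z \<notin> {x', y'} \<and> act w (simple_root s) z \<noteq> 0"
  proof (rule ccontr)
    assume "\<not> ?thesis"
    then have supp: "act w (simple_root s) t = 0" if "t \<notin> {x', y'}" for t using that by blast
    have "x' \<noteq> y'" using gx gy mem(5) g by (metis W_inv(1) simple_root_eq_iff)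
    let ?a = "act w (simple_root s)"
    have "?a = (\<lambda>t. ?a x' * simple_root x' t + ?a y' * simple_root y' t)"
      using supp \<open>x' \<noteq> y'\<close> by (auto simp: fun_eq_iff simple_root_def)
    also have "\<dots> = act w (\<lambda>t. ?a x' * simple_root x t + ?a y' * simple_root y t)"
      using gx gy w(2) by (simp add: act_lin)
    finally have "simple_root s = (\<lambda>t. ?a x' * simple_root x t + ?a y' * simple_root y t)"
      using W_eq_iff[OF g] w(2) by blast
    then have "simple_root s s = ?a x' * simple_root x s + ?a y' * simple_root y s" by (rule fun_cong)
    then show False using sxy by simp
  qed
  then obtain z where z: "z \<noteq> x'" "z \<noteq> y'" "act w (simple_root s) z < 0"
    using neg unfolding nonpos_def by (metis insert_iff order_less_le)
  define c where "c n = [s, x, y] ! (n mod 3)" for n :: nat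
  define u where "u n = map c [0..<n]" for n
  define \<beta> where "\<beta> n = act (u n) (simple_root (c n))" for n
  have c012: "c 0 = s" "c (Suc 0) = x" "c (Suc (Suc 0)) = y" by (simp_all add: c_def)
  have c3: "c (Suc (Suc (Suc n))) = c n" for n
  proof -
    have "Suc (Suc (Suc n)) mod 3 = n mod 3" by presburger
    then show ?thesis by (simp add: c_def)
  qed
  have "n mod 3 = 0 \<or> n mod 3 = 1 \<or> n mod 3 = 2" for n :: nat by presburger
  then have c_cases: "c n \<in> {s, x, y}" for n
    unfolding c_def by (metis One_nat_def insertCI nth_Cons_0 nth_Cons_Suc numeral_2_eq_2)
  have c_ne: "c n \<noteq> c (Suc n)" "c n \<noteq> c (Suc (Suc n))" for n
  proof -
    have "n mod 3 = 0 \<or> n mod 3 = 1 \<or> n mod 3 = 2" by presburger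
    then show "c n \<noteq> c (Suc n)" "c n \<noteq> c (Suc (Suc n))"
      using sxy mem(5) by (auto simp: c_def mod_Suc)
  qed
  have cS: "c n \<in> S" for n using c_cases[of n] s mem by auto
  have u_lists: "u n \<in> lists {s, x, y}" "u n \<in> lists S" for n
    unfolding in_lists_conv_set u_def using c_cases cS by fastforce+
  have step: "act (u (Suc n)) (simple_root t) v = act (u n) (simple_root t) v - cartan (c n) t * \<beta> n v"
    if "t \<in> S" for n t v
    using act_lin[of "u n" 1 "simple_root t" "- cartan (c n) t" "simple_root (c n)"] that
    by (simp add: u_def \<beta>_def reflect_simple_root)
  have rec: "\<beta> (Suc (Suc (Suc n))) v = - cartan (c (Suc (Suc n))) (c n) * \<beta> (Suc (Suc n)) v
      - cartan (c (Suc n)) (c n) * \<beta> (Suc n) v - \<beta> n v" for n v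
    using cS[of n] by (simp add: \<beta>_def[of "Suc (Suc (Suc n))"] c3 step) (simp add: \<beta>_def)
  have \<beta>0: "\<beta> 0 v = simple_root s v" for v by (simp add: \<beta>_def u_def c012)
  have \<beta>1: "\<beta> (Suc 0) v = simple_root x v - cartan s x * \<beta> 0 v" for v
    using mem by (simp add: \<beta>_def[of "Suc 0"] c012 step) (simp add: u_def c012)
  have \<beta>2: "\<beta> (Suc (Suc 0)) v = simple_root y v - cartan s y * \<beta> 0 v - cartan x y * \<beta> (Suc 0) v" for v
    using mem by (simp add: \<beta>_def[of "Suc (Suc 0)"] c012 step) (simp add: u_def c012)
  \<comment> \<open>Large type makes the off-diagonal Cartan entries at most \<open>- 1\<close>; this is why the roots grow.\<close>
  have grow: "b \<le> - cartan i j * b" if "i \<in> S" "j \<in> S" "i \<noteq> j" "0 \<le> b" for i j b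
    using mult_right_mono[of 1 "- cartan i j" b] cartan_le_minus_1[OF large that(1-3)] that(4) by simp
  have mono: "0 \<le> \<beta> n v \<and> \<beta> n v \<le> \<beta> (Suc n) v \<and> \<beta> (Suc n) v \<le> \<beta> (Suc (Suc n)) v" for n v
  proof (induction n)
    case 0
    have nn: "0 \<le> simple_root i v" for i by (simp add: simple_root_def)
    have b0: "0 \<le> \<beta> 0 v" using \<beta>0 by (simp add: simple_root_def)
    have b1: "\<beta> 0 v \<le> \<beta> (Suc 0) v"
      using \<beta>1[of v] grow[OF s(1) mem(1) sxy(1) b0] nn[of x] by linarith
    then have b1': "0 \<le> \<beta> (Suc 0) v" using b0 by linarith
    have "\<beta> (Suc 0) v \<le> \<beta> (Suc (Suc 0)) v"
      using \<beta>2[of v] grow[OF s(1) mem(2) sxy(2) b0] grow[OF mem(1,2,5) b1'] nn[of y] b0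
      by linarith
    then show ?case using b0 b1 by blast
  next
    case (Suc n)
    have g1: "\<beta> (Suc (Suc n)) v \<le> - cartan (c (Suc (Suc n))) (c n) * \<beta> (Suc (Suc n)) v"
      using Suc c_ne[of n] cS by (intro grow) auto
    have g2: "\<beta> (Suc n) v \<le> - cartan (c (Suc n)) (c n) * \<beta> (Suc n) v"
      using Suc c_ne[of n] cS by (intro grow) auto
    have "\<beta> (Suc (Suc n)) v \<le> \<beta> (Suc (Suc (Suc n))) v"
      using g1 g2 Suc rec[of n v] by linarith
    then show ?case using Suc by linarith
  qed
  have \<beta>s: "1 \<le> \<beta> n s" for n
  proof (induction n)
    case 0
    then show ?case by (simp add: \<beta>0)
  next
    case (Suc n)
    then show ?case using mono[of n s] by linarith
  qed
  have "act w (\<beta> n) z < 0" for n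
  proof -
    have "\<beta> n t = 0" if "t \<notin> {s, x, y}" for t
      using act_outside[OF u_lists(1) that, of n "simple_root (c n)"] that c_cases[of n] by (auto simp: \<beta>_def)
    then have "act w (\<beta> n) = (\<lambda>t. \<Sum>v\<in>{s, x, y}. \<beta> n v * act w (simple_root v) t)"
      by (intro act_expand) auto
    then have "act w (\<beta> n) z = \<beta> n s * act w (simple_root s) z"
      using sxy mem(5) gx gy w(2) z by simp
    then show ?thesis using \<beta>s[of n] z(3) by (simp add: mult_pos_neg)
  qed
  then have "\<not> nonneg (act (w @ u n) (simple_root (c n)))" for n
    by (auto simp: nonneg_def \<beta>_def not_le intro!: exI[of _ z])
  then have drop: "len (act (w @ u (Suc n))) < len (act (w @ u n))" for n
    using descent_len[of "w @ u n" "c n"] w u_lists cS by (simp add: u_def)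
  have "len (act (w @ u n)) + n \<le> len (act w)" for n
  proof (induction n)
    case 0
    then show ?case by (simp add: u_def)
  next
    case (Suc n)
    then show ?case using drop[of n] by linarith
  qed
  from this[of "Suc (len (act w))"] show False by simp
qed

end

section \<open>Reading a word while following a coset of the parabolic subgroup\<close>

locale artin_parabolic = coxeter_data S m
  for S :: "'a set" and m +
  fixes X :: "'a set"
  assumes X_subset: "X \<subseteq> S"
begin

text \<open>A state is the inverse \<open>g = v\<^sup>-\<^sup>1\<close> of the shortest element \<open>v\<close> of a coset \<open>W\<^sub>X v\<close>. In terms of
  roots, \<open>v\<close> is shortest iff \<open>g\<close> keeps the simple roots of \<open>X\<close> positive, and \<open>v s v\<^sup>-\<^sup>1 = x\<close> iff
  \<open>g\<close> maps the simple root of \<open>x\<close> to that of \<open>s\<close>.\<close>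

definition states :: "(('a \<Rightarrow> real) \<Rightarrow> 'a \<Rightarrow> real) set" where
  "states = {g \<in> W. \<forall>x\<in>X. nonneg (g (simple_root x))}"

definition emits :: "(('a \<Rightarrow> real) \<Rightarrow> 'a \<Rightarrow> real) \<Rightarrow> 'a \<Rightarrow> bool" where
  "emits g s \<longleftrightarrow> (\<exists>x\<in>X. g (simple_root x) = simple_root s)"

definition emitted :: "(('a \<Rightarrow> real) \<Rightarrow> 'a \<Rightarrow> real) \<Rightarrow> 'a \<Rightarrow> 'a" where
  "emitted g s = (SOME x. x \<in> X \<and> g (simple_root x) = simple_root s)"

definition step :: "(('a \<Rightarrow> real) \<Rightarrow> 'a \<Rightarrow> real) \<Rightarrow> 'a \<Rightarrow> ('a \<Rightarrow> real) \<Rightarrow> 'a \<Rightarrow> real" where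
  "step g s = (if emits g s then g else reflect s \<circ> g)"

text \<open>Positive and negative letters move the state alike, since simple reflections are involutions.\<close>

fun run :: "(('a \<Rightarrow> real) \<Rightarrow> 'a \<Rightarrow> real) \<Rightarrow> 'a word \<Rightarrow> ('a \<Rightarrow> real) \<Rightarrow> 'a \<Rightarrow> real" where
  "run g [] = g"
| "run g ((s, e) # w) = run (step g s) w"

fun out :: "(('a \<Rightarrow> real) \<Rightarrow> 'a \<Rightarrow> real) \<Rightarrow> 'a word \<Rightarrow> 'a word" where
  "out g [] = []"
| "out g ((s, e) # w) = (if emits g s then [(emitted g s, e)] else []) @ out (step g s) w"

lemma run_append [simp]: "run g (v @ w) = run (run g v) w"
  by (induction g v rule: run.induct) auto

lemma out_append [simp]: "out g (v @ w) = out g v @ out (run g v) w"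
  by (induction g v rule: out.induct) auto

lemma states_W: "g \<in> states \<Longrightarrow> g \<in> W"
  by (simp add: states_def)

lemma id_in_states: "id \<in> states"
  by (simp add: states_def id_in_W)

lemma emitted:
  assumes "emits g s"
  shows "emitted g s \<in> X" "g (simple_root (emitted g s)) = simple_root s"
proof -
  have "\<exists>x. x \<in> X \<and> g (simple_root x) = simple_root s" using assms by (auto simp: emits_def)
  from someI_ex[OF this] show "emitted g s \<in> X" "g (simple_root (emitted g s)) = simple_root s"
    by (simp_all add: emitted_def)
qed

lemma emitted_eq:
  assumes "g \<in> W" "x \<in> X" "g (simple_root x) = simple_root s"
  shows "emits g s" "emitted g s = x"
proof -
  show "emits g s" using assms by (auto simp: emits_def)
  from emitted(2)[OF this] show "emitted g s = x"
    using assms W_eq_iff[OF assms(1)] by (metis simple_root_eq_iff)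
qed

lemma step_in_states:
  assumes "g \<in> states" "s \<in> S"
  shows "step g s \<in> states"
proof (cases "emits g s")
  case True
  then show ?thesis using assms by (simp add: step_def)
next
  case False
  have "nonneg (reflect s (g (simple_root x)))" if "x \<in> X" for x
    using assms that False X_subset
    by (intro reflect_positive_root) (auto simp: states_def emits_def)
  then show ?thesis using assms False by (auto simp: step_def states_def reflect_in_W)
qed

lemma emits_step:
  assumes "g \<in> states" "s \<in> S"
  shows "emits (step g s) s \<longleftrightarrow> emits g s"
proof -
  have False if "\<not> emits g s" "x \<in> X" "reflect s (g (simple_root x)) = simple_root s" for x
  proof -
    have "g (simple_root x) = reflect s (simple_root s)" using that(3) assms(2) by (metis reflect_reflect)
    then have "g (simple_root x) = (\<lambda>u. - simple_root s u)" using assms(2) by (simp add: reflect_self)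
    moreover have "nonneg (g (simple_root x))" using assms(1) that(2) by (simp add: states_def)
    ultimately show False using not_nonneg_uminus_simple_root by metis
  qed
  then show ?thesis by (auto simp: step_def emits_def)
qed

text \<open>A letter that moves a state moves it back when it is read again; thus orbits of states under
  a set of letters can be explored from any of their members.\<close>

lemma step_step:
  assumes "g \<in> states" "s \<in> S"
  shows "step (step g s) s = g"
  using emits_step[OF assms] assms(2) by (auto simp: step_def)

lemma run_in_states: "g \<in> states \<Longrightarrow> w \<in> words S \<Longrightarrow> run g w \<in> states"
  by (induction g w rule: run.induct) (auto simp: step_in_states)

lemma run_act:
  assumes "w \<in> words K"
  shows "\<exists>u\<in>lists K. run g w = act u \<circ> g"
  using assms
proof (induction g w rule: run.induct)
  case (1 g)
  then show ?case by (intro bexI[of _ "[]"]) (auto simp: act_Nil_id)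
next
  case (2 g s e w)
  then obtain u where u: "u \<in> lists K" "run (step g s) w = act u \<circ> step g s"
    using words_simps(2) by blast
  have "act u \<circ> step g s = act u \<circ> g \<or> act u \<circ> step g s = act (u @ [s]) \<circ> g"
    by (auto simp: step_def fun_eq_iff)
  then show ?case
  proof
    assume "act u \<circ> step g s = act u \<circ> g"
    then show ?thesis using u by auto
  next
    assume "act u \<circ> step g s = act (u @ [s]) \<circ> g"
    then show ?thesis using u 2 by (intro bexI[of _ "u @ [s]"]) auto
  qed
qed

lemma out_words:
  assumes "\<And>u z x. u \<in> words K \<Longrightarrow> z \<in> K \<Longrightarrow> x \<in> X \<Longrightarrow> run g u (simple_root x) = simple_root z \<Longrightarrow> x \<in> L"
    and "w \<in> words K"
  shows "out g w \<in> words L"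
  using assms(2,1)
proof (induction w rule: rev_induct)
  case (snoc a w)
  obtain z e where a: "a = (z, e)" by (cases a)
  have "emitted (run g w) z \<in> L" if "emits (run g w) z"
    using emitted[OF that] snoc.prems a by auto
  then show ?case using snoc a by auto
qed simp

lemma out_in_words: "w \<in> words S \<Longrightarrow> out g w \<in> words X"
  by (rule out_words[of S]) auto

text \<open>The state is the shortest element in its double coset of \<open>W\<^sub>X\<close> and the subgroup generated
  by \<open>K\<close>.\<close>

definition minimal :: "'a set \<Rightarrow> (('a \<Rightarrow> real) \<Rightarrow> 'a \<Rightarrow> real) \<Rightarrow> bool" where
  "minimal K g \<longleftrightarrow> g \<in> states \<and> (\<forall>z\<in>K. nonneg (ginv g (simple_root z)))"

text \<open>As long as a letter of \<open>K\<close> shortens the state, reading it moves the state without writing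
  anything; reading these letters backwards leads from a minimal state to the given one.\<close>

lemma ex_minimal:
  assumes "K \<subseteq> S" "g \<in> states"
  shows "\<exists>g0 u. minimal K g0 \<and> u \<in> words K \<and> g = run g0 u"
  using assms(2)
proof (induction "len g" arbitrary: g rule: less_induct)
  case (less g)
  show ?case
  proof (cases "minimal K g")
    case True
    then show ?thesis by (intro exI[of _ g] exI[of _ "[]"]) auto
  next
    case False
    then obtain z where z: "z \<in> K" "\<not> nonneg (ginv g (simple_root z))"
      using less.prems by (auto simp: minimal_def)
    have zS: "z \<in> S" using z assms by auto
    have "\<not> emits g z"
      using z(2) states_W[OF less.prems] unfolding emits_def by (metis W_inv(1) nonneg_simple_root)
    then have st: "step g z = reflect z \<circ> g" by (simp add: step_def)
    then have "len (step g z) < len g"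
      using left_descent_len[OF states_W[OF less.prems] zS z(2)] by simp
    then obtain g0 u where u: "minimal K g0" "u \<in> words K" "step g z = run g0 u"
      using less.hyps step_in_states[OF less.prems zS] by blast
    have "g = run g0 (u @ [(z, True)])"
      using u(3) step_step[OF less.prems zS] by simp
    then show ?thesis using u z by (intro exI[of _ g0] exI[of _ "u @ [(z, True)]"]) auto
  qed
qed

text \<open>Reflections in \<open>K\<close> do not touch coordinates outside \<open>K\<close>. So a label written anywhere in the
  \<open>K\<close>-orbit of a minimal state has its root in the span of \<open>K\<close> already at the minimal state, and
  by minimality this root is simple: the label is already written there.\<close>

lemma minimal_emission:
  assumes "K \<subseteq> S" "minimal K g" "u \<in> lists K" "z \<in> K" "x \<in> X"
    and eq: "act u (g (simple_root x)) = simple_root z"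
  shows "\<exists>y\<in>K. g (simple_root x) = simple_root y"
proof (rule positive_on_span_simple[OF _ assms(1)])
  show "g (simple_root x) t = 0" if "t \<notin> K" for t
  proof -
    have "t \<noteq> z" using that assms(4) by auto
    then show ?thesis using act_outside[OF assms(3) that, of "g (simple_root x)"] by (simp add: eq)
  qed
qed (use assms X_subset in \<open>auto simp: minimal_def states_def\<close>)

lemma minimal_run_emission:
  assumes "K \<subseteq> S" "minimal K g" "u \<in> words K" "z \<in> K" "x \<in> X"
    and "run g u (simple_root x) = simple_root z"
  shows "\<exists>y\<in>K. g (simple_root x) = simple_root y"
proof -
  obtain u' where "u' \<in> lists K" "run g u = act u' \<circ> g" using run_act[OF assms(3)] by blast
  then show ?thesis using minimal_emission[OF assms(1,2) _ assms(4,5), of u'] assms(6) by simp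
qed

abbreviation pos :: "'a list \<Rightarrow> 'a word" where
  "pos w \<equiv> map (\<lambda>s. (s, True)) w"

lemma alternating_alt: "alternating s t n = pos (alt s t n)"
  by (simp add: alternating_def alt_def)

lemma run_no_emission:
  assumes "w \<in> words K" "\<And>u z. u \<in> words K \<Longrightarrow> z \<in> K \<Longrightarrow> \<not> emits (run g u) z"
  shows "run g w = act (rev (map fst w)) \<circ> g"
  using assms
proof (induction w rule: rev_induct)
  case Nil
  then show ?case by (simp add: act_Nil_id)
next
  case (snoc a w)
  obtain z e where a: "a = (z, e)" by (cases a)
  have "\<not> emits (run g w) z" using snoc.prems a by auto
  then have "run g (w @ [a]) = reflect z \<circ> run g w" by (simp add: a step_def)
  also have "run g w = act (rev (map fst w)) \<circ> g"
    by (rule snoc.IH) (use snoc.prems in auto)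
  finally show ?case by (simp add: a comp_def fun_eq_iff)
qed

section \<open>The dihedral relations are respected\<close>

text \<open>The shape of a dihedral orbit in which exactly one of the two letters writes at the minimal
  state: a ladder \<open>v 0, \<dots>, v (n - 1)\<close> climbed by alternating letters, with a loop writing the
  same \<open>x\<close> at both ends. An alternating walk of length \<open>n\<close> starting at \<open>v i\<close> meets precisely one of
  the loops, whichever direction it takes first, and ends at \<open>v (n - 1 - i)\<close>.\<close>

lemma ladder:
  fixes v :: "nat \<Rightarrow> ('a \<Rightarrow> real) \<Rightarrow> 'a \<Rightarrow> real" and s t x n
  defines "l \<equiv> \<lambda>i::nat. if even i then t else s"
  assumes up: "\<And>i. Suc i < n \<Longrightarrow> \<not> emits (v i) (l i) \<and> step (v i) (l i) = v (Suc i)"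
    and down: "\<And>i. Suc i < n \<Longrightarrow> \<not> emits (v (Suc i)) (l i) \<and> step (v (Suc i)) (l i) = v i"
    and bot: "emits (v 0) s" "emitted (v 0) s = x"
    and top: "emits (v (n - 1)) (l (n - 1))" "emitted (v (n - 1)) (l (n - 1)) = x"
    and i: "i < n" and n: "z \<in> {s, t}" "z' \<in> {s, t}" "z \<noteq> z'"
  shows "run (v i) (pos (alt z z' n)) = v (n - 1 - i) \<and> out (v i) (pos (alt z z' n)) = [(x, True)]"
proof -
  have ups: "run (v i) (pos (alt (l i) (l (Suc i)) k)) = v (i + k)
      \<and> out (v i) (pos (alt (l i) (l (Suc i)) k)) = []" if "i + k < n" for i k
    using that
  proof (induction k)
    case (Suc k)
    have "(if even k then l i else l (Suc i)) = l (i + k)" by (auto simp: l_def)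
    then show ?case using Suc up[of "i + k"] by (simp add: alt_Suc)
  qed simp
  have downs: "run (v i) (pos (alt (l (Suc i)) (l i) k)) = v (i - k)
      \<and> out (v i) (pos (alt (l (Suc i)) (l i) k)) = []" if "k \<le> i" "i < n" for i k
    using that
  proof (induction k)
    case (Suc k)
    have "(if even k then l (Suc i) else l i) = l (i - Suc k)" using Suc.prems by (auto simp: l_def)
    moreover have "i - k = Suc (i - Suc k)" using Suc.prems by simp
    ultimately show ?case using Suc down[of "i - Suc k"] by (simp add: alt_Suc)
  qed simp
  have "alt (l i) (l (Suc i)) ((n - 1 - i) + Suc i)
      = alt (l i) (l (Suc i)) (n - 1 - i) @ l (n - 1) # alt (l (Suc (n - 1))) (l (n - 1)) i"
    unfolding alt_add using i by (auto simp: alt_Suc_Cons l_def)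
  moreover have "(n - 1 - i) + Suc i = n" using i by simp
  ultimately have A: "alt (l i) (l (Suc i)) n
      = alt (l i) (l (Suc i)) (n - 1 - i) @ l (n - 1) # alt (l (Suc (n - 1))) (l (n - 1)) i" by metis
  have "step (v (n - 1)) (l (n - 1)) = v (n - 1)" using top by (simp add: step_def)
  then have full_up: "run (v i) (pos (alt (l i) (l (Suc i)) n)) = v (n - 1 - i)
      \<and> out (v i) (pos (alt (l i) (l (Suc i)) n)) = [(x, True)]"
    using ups[of i "n - 1 - i"] downs[of i "n - 1"] i top unfolding A by simp
  have "alt (l (Suc i)) (l i) (i + Suc (n - 1 - i))
      = alt (l (Suc i)) (l i) i @ s # alt (l 0) (l (Suc 0)) (n - 1 - i)"
    unfolding alt_add by (auto simp: alt_Suc_Cons l_def)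
  moreover have "i + Suc (n - 1 - i) = n" using i by simp
  ultimately have B: "alt (l (Suc i)) (l i) n
      = alt (l (Suc i)) (l i) i @ s # alt (l 0) (l (Suc 0)) (n - 1 - i)" by metis
  have "step (v 0) s = v 0" using bot by (simp add: step_def)
  then have full_down: "run (v i) (pos (alt (l (Suc i)) (l i) n)) = v (n - 1 - i)
      \<and> out (v i) (pos (alt (l (Suc i)) (l i) n)) = [(x, True)]"
    using downs[of i i] ups[of 0 "n - 1 - i"] i bot unfolding B by simp
  have "(z = l i \<and> z' = l (Suc i)) \<or> (z = l (Suc i) \<and> z' = l i)"
    using n by (auto simp: l_def)
  then show ?thesis using full_up full_down by blast
qed

text \<open>On the \<open>i\<close>-th rung the root of \<open>x\<close> has Chebyshev coefficients \<open>i\<close> and \<open>i + 1\<close>. Neither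
  coefficient vanishes strictly between the ends, and on rung \<open>n - 1\<close> they are \<open>1\<close> and \<open>0\<close>, so that
  the root is simple again and the loop at the top writes \<open>x\<close> as well.\<close>

lemma dihedral_one_sided:
  assumes st: "s \<in> S" "t \<in> S" "s \<noteq> t" "m s t = enat n"
    and min: "minimal {s, t} g0" and x: "x \<in> X" "g0 (simple_root x) = simple_root s"
    and no: "\<not> emits g0 t" and u: "u \<in> words {s, t}"
  shows "\<exists>h. \<forall>z z'. {z, z'} = {s, t} \<longrightarrow> run (run g0 u) (alternating z z' n) = h
    \<and> out (run g0 u) (alternating z z' n) = [(x, True)]"
proof -
  define l where "l i = (if even i then t else s)" for i :: nat
  define v where "v i = act (rev (alt t s i)) \<circ> g0" for i
  have n2: "2 \<le> n" using label_finite_ge_2[OF st] .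
  have lS: "l i \<in> S" "l i \<in> {s, t}" for i using st by (auto simp: l_def)
  have g0: "g0 \<in> states" using min by (simp add: minimal_def)
  have lists: "rev (alt t s i) \<in> lists {s, t}" for i
    using alt_in_lists[of t "{s, t}" s i] by (auto simp: in_lists_conv_set)
  have v0: "v 0 = g0" by (simp add: v_def act_Nil_id)
  have vSuc: "v (Suc i) = reflect (l i) \<circ> v i" for i by (auto simp: v_def alt_Suc l_def)
  have vx: "v i (simple_root x) = (\<lambda>u. cheb (- cartan s t) (Suc i) * simple_root (l (Suc i)) u
          + cheb (- cartan s t) i * simple_root (l i) u)" for i
    using act_alt_simple_root[OF st(1,2), of i] x by (simp add: v_def l_def)
  have only_x: "y = x" if "y \<in> X" "z \<in> {s, t}" "v i (simple_root y) = simple_root z" for y z i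
  proof -
    have "\<exists>z'\<in>{s, t}. g0 (simple_root y) = simple_root z'"
      using that st lists by (intro minimal_emission[OF _ min, of "rev (alt t s i)" z]) (auto simp: v_def)
    then have "g0 (simple_root y) = simple_root s" using no that(1) by (auto simp: emits_def)
    then show ?thesis using x W_eq_iff[OF states_W[OF g0]] by (metis simple_root_eq_iff)
  qed
  have no_emit: "\<not> emits (v i) (l i)" if "Suc i < n" for i
  proof
    assume "emits (v i) (l i)"
    then obtain y where y: "y \<in> X" "v i (simple_root y) = simple_root (l i)" by (auto simp: emits_def)
    then have "v i (simple_root x) = simple_root (l i)" using only_x[OF y(1) lS(2) y(2)] by simp
    from fun_cong[OF this, of "l (Suc i)"] have "cheb (- cartan s t) (Suc i) = 0"
      using st(3) by (simp add: vx l_def split: if_splits)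
    then show False using cheb_pos[OF st(1-3) _ st(4) that] by simp
  qed
  have up: "\<not> emits (v i) (l i) \<and> step (v i) (l i) = v (Suc i)" if "Suc i < n" for i
    using no_emit[OF that] by (simp add: step_def vSuc)
  have vst: "v i \<in> states" if "i < n" for i
    using that
  proof (induction i)
    case (Suc i)
    then show ?case using step_in_states[of "v i" "l i"] up[of i] lS by simp
  qed (simp add: v0 g0)
  have down: "\<not> emits (v (Suc i)) (l i) \<and> step (v (Suc i)) (l i) = v i" if "Suc i < n" for i
    using emits_step[OF vst lS(1), of i i] step_step[OF vst lS(1), of i i] up[OF that] that by simp
  have bot: "emits (v 0) s" "emitted (v 0) s = x"
    using emitted_eq[OF states_W[OF g0] x] by (simp_all add: v0)
  have "v (n - 1) (simple_root x) = simple_root (l (n - 1))"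
    using cheb_label[OF st] n2 by (simp add: vx)
  then have top: "emits (v (n - 1)) (l (n - 1))" "emitted (v (n - 1)) (l (n - 1)) = x"
    using emitted_eq[OF states_W[OF vst] x(1), of "n - 1"] n2 by auto
  have "\<exists>i<n. run g0 u = v i" using u
  proof (induction u rule: rev_induct)
    case Nil
    then show ?case using n2 v0 by (intro exI[of _ 0]) auto
  next
    case (snoc a u)
    obtain z e where a: "a = (z, e)" by (cases a)
    obtain i where i: "i < n" "run g0 u = v i" using snoc by auto
    have z: "z = l i \<or> z = l (Suc i)" using snoc.prems a by (auto simp: l_def)
    show ?case
    proof (cases "z = l i")
      case True
      show ?thesis
      proof (cases "Suc i < n")
        case True
        then show ?thesis using i \<open>z = l i\<close> up[of i] a by auto
      next
        case False
        then have "n - 1 = i" using i by simp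
        then show ?thesis using i \<open>z = l i\<close> top a by (auto simp: step_def)
      qed
    next
      case False
      then have z: "z = l (Suc i)" using z by simp
      show ?thesis
      proof (cases i)
        case 0
        then show ?thesis using i z bot a by (auto simp: step_def l_def)
      next
        case (Suc j)
        then have "z = l j" using z by (simp add: l_def)
        then show ?thesis using i Suc down[of j] a by (intro exI[of _ j]) auto
      qed
    qed
  qed
  then obtain i where i: "i < n" "run g0 u = v i" by blast
  have "run (v i) (pos (alt z z' n)) = v (n - 1 - i) \<and> out (v i) (pos (alt z z' n)) = [(x, True)]"
    if z: "{z, z'} = {s, t}" for z z'
  proof -
    have "z \<in> {s, t}" "z' \<in> {s, t}" "z \<noteq> z'" using z st(3) by (auto simp: doubleton_eq_iff)
    then show ?thesis
      using up down bot top i by (intro ladder[of n v t s x i z z']) (auto simp: l_def[abs_def])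
  qed
  then show ?thesis using i by (intro exI[of _ "v (n - 1 - i)"]) (simp add: alternating_alt)
qed

end

context artin_parabolic
begin

lemma run_fixed:
  assumes "w \<in> words K" "\<And>z. z \<in> K \<Longrightarrow> emits g z"
  shows "run g w = g" "out g w = map (\<lambda>(s, e). (emitted g s, e)) w"
  using assms by (induction w) (auto simp: step_def)

text \<open>At the minimal state of the orbit of \<open>s\<close> and \<open>t\<close> either both letters write, and the relation is
  copied to a relation between the labels, which have the same \<open>m\<close> because the form is
  invariant; or exactly one writes, and both sides write this single label; or none writes,
  and the braid relation in \<open>W\<close> says that both sides end in the same state.\<close>

lemma dihedral_relation:
  assumes st: "s \<in> S" "t \<in> S" "s \<noteq> t" "m s t = enat n" and g: "g \<in> states"
  shows "run g (alternating s t n) = run g (alternating t s n)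
    \<and> (out g (alternating s t n), out g (alternating t s n)) \<in> pres_eq X (artin_relations X m)"
proof -
  have ts: "m t s = enat n" using labelsD(1)[OF st(1-3)] st(4) by simp
  have alts: "alternating s t n \<in> words {s, t}" "alternating t s n \<in> words {s, t}"
    by (auto simp: alternating_def words_def)
  have KS: "{s, t} \<subseteq> S" using st by simp
  obtain g0 u where u: "minimal {s, t} g0" "u \<in> words {s, t}" "g = run g0 u"
    using ex_minimal[OF KS g] by blast
  have g0: "g0 \<in> W" "g0 \<in> states" using u by (simp_all add: minimal_def states_W)
  have same: "(w, w) \<in> pres_eq X (artin_relations X m)" if "w \<in> words X" for w
    using that by (rule pres_eq.refl)
  consider (both) "emits g0 s" "emits g0 t" | (s) "emits g0 s" "\<not> emits g0 t"
    | (t) "\<not> emits g0 s" "emits g0 t" | (none) "\<not> emits g0 s" "\<not> emits g0 t" by blast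
  then show ?thesis
  proof cases
    case both
    define x y where "x = emitted g0 s" and "y = emitted g0 t"
    have xy: "x \<in> X" "y \<in> X" "g0 (simple_root x) = simple_root s" "g0 (simple_root y) = simple_root t"
      using emitted both by (simp_all add: x_def y_def)
    have "x \<noteq> y" using xy st by auto
    have "cartan s t = form (simple_root s) (simple_root t)" using st by simp
    also have "\<dots> = form (g0 (simple_root x)) (g0 (simple_root y))" using xy by simp
    also have "\<dots> = form (simple_root x) (simple_root y)" using form_W[OF g0(1)] .
    also have "\<dots> = cartan x y" using subsetD[OF X_subset xy(1)] subsetD[OF X_subset xy(2)] by simp
    \<comment> \<open>The form determines the label, so \<open>x\<close> and \<open>y\<close> satisfy a relation of the same length.\<close>
    finally have "m x y = enat n"
      using label_eq_if_cartan_eq[OF st] xy X_subset \<open>x \<noteq> y\<close> by blast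
    then have rel: "(alternating x y n, alternating y x n) \<in> artin_relations X m"
      using xy \<open>x \<noteq> y\<close> by (auto simp: artin_relations_def)
    have "alternating x y n \<in> words X" "alternating y x n \<in> words X"
      using xy by (auto simp: alternating_def words_def)
    then have "(alternating x y n, alternating y x n) \<in> pres_eq X (artin_relations X m)"
      using pres_eq.relation[OF rel, of X "[]" "[]"] by simp
    moreover have stay: "run g0 w = g0" "out g0 w = map (\<lambda>(s, e). (emitted g0 s, e)) w"
      if "w \<in> words {s, t}" for w
      using run_fixed[OF that, of g0] both by auto
    moreover have "map (\<lambda>(r, e). (emitted g0 r, e)) (alternating z z' n)
        = alternating (emitted g0 z) (emitted g0 z') n" for z z'
      by (auto simp: alternating_def)
    ultimately show ?thesis
      using u alts by (simp add: stay x_def y_def)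
  next
    case s
    then obtain h where "\<forall>z z'. {z, z'} = {s, t} \<longrightarrow> run g (alternating z z' n) = h
        \<and> out g (alternating z z' n) = [(emitted g0 s, True)]"
      using dihedral_one_sided[OF st u(1) _ _ _ u(2)] emitted u(3) by blast
    moreover have "{t, s} = {s, t}" by auto
    ultimately show ?thesis using same[of "[(emitted g0 s, True)]"] emitted[OF s(1)] by simp
  next
    case t
    have min: "minimal {t, s} g0" "u \<in> words {t, s}" using u by (simp_all add: insert_commute)
    obtain h where "\<forall>z z'. {z, z'} = {t, s} \<longrightarrow> run g (alternating z z' n) = h
        \<and> out g (alternating z z' n) = [(emitted g0 t, True)]"
      using dihedral_one_sided[OF st(2,1) st(3)[symmetric] ts min(1) _ _ _ min(2)] emitted t u(3) by blast
    moreover have "{t, s} = {s, t}" by auto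
    ultimately show ?thesis using same[of "[(emitted g0 t, True)]"] emitted[OF t(2)] by simp
  next
    case none
    have no: "run g v (simple_root x) \<noteq> simple_root z" if "v \<in> words {s, t}" "z \<in> {s, t}" "x \<in> X" for v z x
    proof
      assume eq: "run g v (simple_root x) = simple_root z"
      have "\<exists>y\<in>{s, t}. g0 (simple_root x) = simple_root y"
        using minimal_run_emission[OF KS u(1) _ that(2,3), of "u @ v"] that(1) u eq by simp
      then show False using none that(3) by (auto simp: emits_def)
    qed
    have "out g (alternating s t n) \<in> words {}" "out g (alternating t s n) \<in> words {}"
      using out_words[of "{s, t}" g "{}"] no alts by blast+
    then have "out g (alternating s t n) = []" "out g (alternating t s n) = []"
      by (simp_all add: words_def)
    moreover have run: "run g w = act (rev (map fst w)) \<circ> g" if "w \<in> words {s, t}" for w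
      using that no by (intro run_no_emission) (auto simp: emits_def)
    have "map fst (alternating z z' n) = alt z z' n" for z z' :: 'a
      by (simp add: alternating_alt comp_def)
    then have "run g (alternating s t n) = run g (alternating t s n)"
      using run alts braid[OF st] by simp
    ultimately show ?thesis using same[of "[]"] by simp
  qed
qed

text \<open>Cancellation of \<open>s s\<^sup>-\<^sup>1\<close> is respected because \<open>s\<close> acts on states as an involution that writes
  the same label both times or never; defining relations by \<open>dihedral_relation\<close>.\<close>

theorem retraction_respects:
  assumes "(v, w) \<in> pres_eq S (artin_relations S m)" "g \<in> states"
  shows "run g v = run g w \<and> (out g v, out g w) \<in> pres_eq X (artin_relations X m)"
  using assms
proof (induction arbitrary: g rule: pres_eq.induct)
  case (refl w)
  then show ?case by (auto intro: pres_eq.refl out_in_words)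
next
  case (sym v w)
  then show ?case by (metis pres_eq.sym)
next
  case (trans u v w)
  then show ?case by (metis pres_eq.trans)
next
  case (cancel s u v e)
  let ?g = "run g u"
  have g: "?g \<in> states" using cancel by (simp add: run_in_states)
  have ss: "step (step ?g s) s = ?g" using step_step[OF g] cancel by simp
  have out: "out ?g v \<in> words X" "out g u \<in> words X" using cancel by (simp_all add: out_in_words)
  show ?case
  proof (cases "emits ?g s")
    case True
    then have "step ?g s = ?g" by (simp add: step_def)
    then show ?thesis
      using True out emitted[OF True]
        pres_eq.cancel[of "emitted ?g s" X "out g u" "out ?g v" e] by simp
  next
    case False
    then have "\<not> emits (step ?g s) s" using emits_step[OF g] cancel by simp
    then show ?thesis using False ss out by (simp add: pres_eq.refl)
  qed
next
  case (relation l r u v)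
  let ?g = "run g u"
  have g: "?g \<in> states" using relation by (simp add: run_in_states)
  obtain s t n where st: "s \<in> S" "t \<in> S" "s \<noteq> t" "m s t = enat n"
      "l = alternating s t n" "r = alternating t s n"
    using relation.hyps(1) by (auto simp: artin_relations_def)
  have rel: "run ?g l = run ?g r" "(out ?g l, out ?g r) \<in> pres_eq X (artin_relations X m)"
    using dihedral_relation[OF st(1-4) g] st(5,6) by auto
  then show ?case
    using pres_eq_context[OF rel(2), of "out g u" "out (run ?g r) v"] relation by (simp add: out_in_words)
qed

lemma id_run:
  assumes "w \<in> words X"
  shows "run id w = id" "out id w = w"
proof -
  have e: "emits id z" "emitted id z = z" if "z \<in> X" for z
    using emitted_eq[OF id_in_W that, of z] by simp_all
  then show "run id w = id" "out id w = w"
    using assms by (induction w) (auto simp: step_def)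
qed

text \<open>The retraction started at the identity fixes all words over \<open>X\<close>, so two of them that are
  equal in the large group are equal in the small one.\<close>

theorem parabolic_embeds:
  assumes "v \<in> words X" "w \<in> words X" "(v, w) \<in> pres_eq S (artin_relations S m)"
  shows "(v, w) \<in> pres_eq X (artin_relations X m)"
  using retraction_respects[OF assms(3) id_in_states] assms(1,2) by (simp add: id_run)

text \<open>Everything written in the double coset of \<open>g\<close> is already written at its minimal state,
  which maps the simple root of each label to a simple root. Two labels would thus force the
  minimal state, and with it \<open>g\<close>, to be the identity.\<close>

lemma single_emission:
  assumes large: "large_type S m" and g: "g \<in> states" "g \<noteq> id" and "X \<noteq> {}"
  obtains x where "x \<in> X" "\<And>u. u \<in> words X \<Longrightarrow> out g u \<in> words {x}"
proof -
  obtain g0 u where u: "minimal X g0" "u \<in> words X" "g = run g0 u"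
    using ex_minimal[OF X_subset g(1)] by blast
  have g0: "g0 \<in> W" using u by (simp add: minimal_def states_W)
  have "g0 \<noteq> id" using id_run[OF u(2)] u(3) g(2) by auto
  have emits0: "\<exists>y\<in>X. g0 (simple_root x) = simple_root y"
    if "v \<in> words X" "z \<in> X" "x \<in> X" "run g v (simple_root x) = simple_root z" for v z x
    using minimal_run_emission[OF X_subset u(1) _ that(2,3), of "u @ v"] that u by simp
  have unique: "x = x'" if xs: "x \<in> X" "x' \<in> X" "y \<in> X" "y' \<in> X"
      "g0 (simple_root x) = simple_root y" "g0 (simple_root x') = simple_root y'" for x x' y y'
    using id_if_two_simple_roots_preserved[OF large g0, of x x' y y'] xs X_subset \<open>g0 \<noteq> id\<close> by auto
  obtain x where x: "x \<in> X"
    "\<And>x'. x' \<in> X \<Longrightarrow> \<exists>y\<in>X. g0 (simple_root x') = simple_root y \<Longrightarrow> x' = x"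
    using unique \<open>X \<noteq> {}\<close> by (cases "\<exists>x\<in>X. \<exists>y\<in>X. g0 (simple_root x) = simple_root y") blast+
  have "out g v \<in> words {x}" if "v \<in> words X" for v
    using x(2) emits0 by (intro out_words[OF _ that]) (metis singletonI)
  then show thesis using that x(1) by blast
qed

end

section \<open>Exponent sums over odd components\<close>

definition exponent_sum :: "'a set \<Rightarrow> 'a word \<Rightarrow> int" where
  "exponent_sum D w = (\<Sum>(s, e)\<leftarrow>w. if s \<in> D then if e then 1 else - 1 else 0)"

lemma exponent_sum_simps [simp]:
  "exponent_sum D [] = 0"
  "exponent_sum D ((s, e) # w) = (if s \<in> D then if e then 1 else - 1 else 0) + exponent_sum D w"
  "exponent_sum D (v @ w) = exponent_sum D v + exponent_sum D w"
  by (simp_all add: exponent_sum_def)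

lemma alternating_Suc: "alternating s t (Suc n) = alternating s t n @ [(if even n then s else t, True)]"
  by (simp add: alternating_def)

lemma alternating_Suc_Cons: "alternating s t (Suc n) = (s, True) # alternating t s n"
  by (induction n) (auto simp: alternating_Suc, simp_all add: alternating_def)

lemma exponent_sum_alternating:
  "exponent_sum D (alternating s t n)
     = int (if s \<in> D then (n + 1) div 2 else 0) + int (if t \<in> D then n div 2 else 0)"
proof (induction n arbitrary: s t)
  case 0
  then show ?case by (simp add: alternating_def)
next
  case (Suc n)
  then show ?case by (simp add: alternating_Suc_Cons)
qed

text \<open>The two sides of a relation of even length contain both letters equally often; those of odd
  length do not, but then \<open>D\<close> does not separate the two letters.\<close>

lemma exponent_sum_pres_eq:
  assumes "(v, w) \<in> pres_eq Y (artin_relations Y m)"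
    and D: "\<And>s t. odd_edge Y m s t \<Longrightarrow> s \<in> D \<longleftrightarrow> t \<in> D"
  shows "exponent_sum D v = exponent_sum D w"
  using assms(1)
proof (induction rule: pres_eq.induct)
  case (relation l r u v)
  then obtain s t n where st: "s \<in> Y" "t \<in> Y" "s \<noteq> t" "m s t = enat n"
      "l = alternating s t n" "r = alternating t s n"
    by (auto simp: artin_relations_def)
  have "s \<in> D \<longleftrightarrow> t \<in> D" if "odd n"
    using that st by (intro D) (simp add: odd_edge_def coxeter_edge_def)
  then have "exponent_sum D l = exponent_sum D r"
    by (cases "even n") (auto simp: st exponent_sum_alternating elim!: evenE)
  then show ?case by simp
qed auto

lemma odd_connected_refl: "a \<in> Y \<Longrightarrow> odd_connected Y m a a"
  unfolding odd_connected_def odd_path_def by (intro exI[of _ "[a]"]) auto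

lemma odd_connected_step:
  assumes "odd_connected Y m a b" "odd_edge Y m b c"
  shows "odd_connected Y m a c"
proof -
  obtain p where p: "odd_path Y m p" "hd p = a" "last p = b"
    using assms(1) by (auto simp: odd_connected_def)
  then have "odd_path Y m (p @ [c])"
    using assms(2) by (auto simp: odd_path_def successively_append_iff odd_edge_def coxeter_edge_def)
  then show ?thesis
    using p by (auto simp: odd_connected_def odd_path_def intro!: exI[of _ "p @ [c]"])
qed

lemma odd_edge_sym: "artin_labels Y m \<Longrightarrow> odd_edge Y m s t \<Longrightarrow> odd_edge Y m t s"
  by (auto simp: odd_edge_def coxeter_edge_def artin_labels_def)

lemma odd_component_closed:
  assumes "artin_labels Y m" "odd_edge Y m s t"
  shows "odd_connected Y m a s \<longleftrightarrow> odd_connected Y m a t"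
  using odd_connected_step assms odd_edge_sym by metis

section \<open>Conjugating words\<close>

text \<open>Conjugacy \<open>q u q\<^sup>-\<^sup>1 = v\<close> written without inverses.\<close>

definition intertwines :: "'a set \<Rightarrow> ('a \<Rightarrow> 'a \<Rightarrow> enat) \<Rightarrow> 'a word \<Rightarrow> 'a word \<Rightarrow> 'a word \<Rightarrow> bool" where
  "intertwines Y m q u v \<longleftrightarrow> q \<in> words Y \<and> (q @ u, v @ q) \<in> pres_eq Y (artin_relations Y m)"

lemma intertwines_words: "intertwines Y m q u v \<Longrightarrow> q \<in> words Y \<and> u \<in> words Y \<and> v \<in> words Y"
  unfolding intertwines_def using pres_eq_words by fastforce

lemma intertwines_trans:
  assumes "intertwines Y m p u v" "intertwines Y m q v w"
  shows "intertwines Y m (q @ p) u w"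
proof -
  note w = intertwines_words[OF assms(1)] intertwines_words[OF assms(2)]
  have "(q @ (p @ u) @ [], q @ (v @ p) @ []) \<in> pres_eq Y (artin_relations Y m)"
    using assms w by (intro pres_eq_context) (auto simp: intertwines_def)
  moreover have "([] @ (q @ v) @ p, [] @ (w @ q) @ p) \<in> pres_eq Y (artin_relations Y m)"
    using assms w by (intro pres_eq_context) (auto simp: intertwines_def)
  ultimately show ?thesis using w by (auto simp: intertwines_def intro: pres_eq.trans)
qed

lemma intertwines_append:
  assumes "intertwines Y m q u v" "intertwines Y m q u' v'"
  shows "intertwines Y m q (u @ u') (v @ v')"
proof -
  note w = intertwines_words[OF assms(1)] intertwines_words[OF assms(2)]
  have "([] @ (q @ u) @ u', [] @ (v @ q) @ u') \<in> pres_eq Y (artin_relations Y m)"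
    using assms w by (intro pres_eq_context) (auto simp: intertwines_def)
  moreover have "(v @ (q @ u') @ [], v @ (v' @ q) @ []) \<in> pres_eq Y (artin_relations Y m)"
    using assms w by (intro pres_eq_context) (auto simp: intertwines_def)
  ultimately show ?thesis using w by (auto simp: intertwines_def intro: pres_eq.trans)
qed

lemma inv_word_inv_word [simp]: "inv_word (inv_word w) = w"
  by (auto simp: inv_word_def rev_map comp_def case_prod_beta)

lemma inv_word_cancel_right: "w \<in> words S \<Longrightarrow> (w @ inv_word w, []) \<in> pres_eq S R"
  using inv_word_cancel[of "inv_word w" S R] by (simp add: inv_word_words)

lemma intertwines_inverse:
  assumes "intertwines Y m q u v"
  shows "intertwines Y m (inv_word q) v u"
proof -
  let ?E = "pres_eq Y (artin_relations Y m)"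
  have w: "q \<in> words Y" "u \<in> words Y" "v \<in> words Y" "inv_word q \<in> words Y"
    using intertwines_words[OF assms] inv_word_words by auto
  have A: "((inv_word q @ v) @ (q @ inv_word q) @ [], (inv_word q @ v) @ [] @ []) \<in> ?E"
    using w by (intro pres_eq_context inv_word_cancel_right) auto
  have B: "(inv_word q @ (q @ u) @ inv_word q, inv_word q @ (v @ q) @ inv_word q) \<in> ?E"
    using w assms by (intro pres_eq_context) (auto simp: intertwines_def)
  have C: "([] @ (inv_word q @ q) @ (u @ inv_word q), [] @ [] @ (u @ inv_word q)) \<in> ?E"
    using w by (intro pres_eq_context inv_word_cancel) auto
  note nf = append.assoc append.left_neutral append.right_neutral
  have "(inv_word q @ v, u @ inv_word q) \<in> ?E"
    by (rule pres_eq.trans[OF pres_eq.sym[OF A[unfolded nf]] pres_eq.trans[OF pres_eq.sym[OF B[unfolded nf]] C[unfolded nf]]])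
  then show ?thesis using w by (simp add: intertwines_def)
qed

lemma intertwines_inv_word:
  assumes "intertwines Y m q u v"
  shows "intertwines Y m q (inv_word u) (inv_word v)"
proof -
  let ?E = "pres_eq Y (artin_relations Y m)"
  have w: "q \<in> words Y" "u \<in> words Y" "v \<in> words Y" "inv_word u \<in> words Y" "inv_word v \<in> words Y"
    using intertwines_words[OF assms] inv_word_words by auto
  have A: "((inv_word v @ q) @ (u @ inv_word u) @ [], (inv_word v @ q) @ [] @ []) \<in> ?E"
    using w by (intro pres_eq_context inv_word_cancel_right) auto
  have B: "(inv_word v @ (q @ u) @ inv_word u, inv_word v @ (v @ q) @ inv_word u) \<in> ?E"
    using w assms by (intro pres_eq_context) (auto simp: intertwines_def)
  have C: "([] @ (inv_word v @ v) @ (q @ inv_word u), [] @ [] @ (q @ inv_word u)) \<in> ?E"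
    using w by (intro pres_eq_context inv_word_cancel) auto
  note nf = append.assoc append.left_neutral append.right_neutral
  have "(q @ inv_word u, inv_word v @ q) \<in> ?E"
    by (rule pres_eq.trans[OF pres_eq.sym[OF C[unfolded nf]] pres_eq.trans[OF pres_eq.sym[OF B[unfolded nf]] A[unfolded nf]]])
  then show ?thesis using w by (simp add: intertwines_def)
qed

definition power_word :: "'a \<Rightarrow> int \<Rightarrow> 'a word" where
  "power_word x k = replicate (nat \<bar>k\<bar>) (x, 0 \<le> k)"

lemma power_word_words: "x \<in> Y \<Longrightarrow> power_word x k \<in> words Y"
  by (auto simp: power_word_def words_def in_lists_conv_set)

lemma power_word_0 [simp]: "power_word x 0 = []"
  by (simp add: power_word_def)

lemma power_word_pos: "0 \<le> k \<Longrightarrow> power_word x (k + 1) = (x, True) # power_word x k"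
  by (simp add: power_word_def nat_add_distrib)

lemma power_word_neg: "k \<le> 0 \<Longrightarrow> power_word x (k - 1) = (x, False) # power_word x k"
proof -
  assume k: "k \<le> 0"
  then have "nat \<bar>k - 1\<bar> = Suc (nat \<bar>k\<bar>)" by simp
  then show ?thesis using k by (cases "k = 0") (simp_all add: power_word_def)
qed

lemma exponent_sum_power_word [simp]: "exponent_sum D (power_word x k) = (if x \<in> D then k else 0)"
proof -
  have "exponent_sum D (replicate n (x, e)) = (if x \<in> D then if e then int n else - int n else 0)" for n e
    by (induction n) auto
  then show ?thesis by (simp add: power_word_def)
qed

lemma Cons_power_word:
  assumes "x \<in> Y"
  shows "((x, e) # power_word x k, power_word x (if e then k + 1 else k - 1)) \<in> pres_eq Y R"
proof -
  have same: "(power_word x j, power_word x j) \<in> pres_eq Y R" for j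
    using assms by (intro pres_eq.refl power_word_words)
  have "((x, e) # (x, \<not> e) # power_word x j, power_word x j) \<in> pres_eq Y R" for j e
    using pres_eq.cancel[of x Y "[]" "power_word x j" e] assms by (simp add: power_word_words)
  note cancel = this[of True "k + 1"] this[of False "k - 1"]
  consider "e" "0 \<le> k" | "e" "k + 1 \<le> 0" | "\<not> e" "k \<le> 0" | "\<not> e" "0 \<le> k - 1" by linarith
  then show ?thesis
  proof cases
    case 1
    then show ?thesis using same[of "k + 1"] by (simp add: power_word_pos)
  next
    case 2
    then show ?thesis using cancel(1) power_word_neg[of "k + 1" x] by simp
  next
    case 3
    then show ?thesis using same[of "k - 1"] by (simp add: power_word_neg)
  next
    case 4
    then show ?thesis using cancel(2) power_word_pos[of "k - 1" x] by simp
  qed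
qed

lemma single_letter_word:
  assumes "x \<in> Y" "w \<in> words {x}"
  shows "(w, power_word x (exponent_sum {x} w)) \<in> pres_eq Y R"
  using assms(2)
proof (induction w)
  case Nil
  then show ?case by (simp add: pres_eq.refl)
next
  case (Cons a w)
  obtain e where a: "a = (x, e)" using Cons.prems by (cases a) auto
  let ?k = "exponent_sum {x} w"
  have "([(x, e)] @ w @ [], [(x, e)] @ power_word x ?k @ []) \<in> pres_eq Y R"
    using Cons assms(1) by (intro pres_eq_context) auto
  from pres_eq.trans[OF _ Cons_power_word[OF assms(1)], of _ e ?k] this
  have "((x, e) # w, power_word x (if e then ?k + 1 else ?k - 1)) \<in> pres_eq Y R" by simp
  moreover have "(if e then ?k + 1 else ?k - 1) = exponent_sum {x} (a # w)" by (simp add: a)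
  ultimately show ?case by (simp add: a)
qed

lemma intertwines_power_word:
  assumes "intertwines Y m q [(a, True)] [(b, True)]"
  shows "intertwines Y m q (power_word a k) (power_word b k)"
proof -
  have q: "q \<in> words Y" using intertwines_words[OF assms] by blast
  have "intertwines Y m q [(a, e)] [(b, e)]" for e
    using assms intertwines_inv_word[OF assms] by (cases e) (simp_all add: inv_word_def)
  then have "intertwines Y m q (replicate n (a, e)) (replicate n (b, e))" for n e
  proof (induction n)
    case 0
    then show ?case using q by (simp add: intertwines_def pres_eq.refl)
  next
    case (Suc n)
    then show ?case using intertwines_append[of Y m q "[(a, e)]" "[(b, e)]"] by simp
  qed
  then show ?thesis by (simp add: power_word_def)
qed

text \<open>For odd \<open>n\<close> the relation \<open>a b \<dots> a = b a \<dots> b\<close> reads \<open>q a = b q\<close>, where \<open>q\<close> is the alternating word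
  with \<open>n - 1\<close> letters.\<close>

lemma odd_edge_intertwines:
  assumes "odd_edge Y m a b"
  shows "\<exists>q. intertwines Y m q [(a, True)] [(b, True)]"
proof -
  have ab: "a \<in> Y" "b \<in> Y" "a \<noteq> b" using assms by (auto simp: odd_edge_def coxeter_edge_def)
  obtain n where n: "m a b = enat n" "odd n"
    using assms by (cases "m a b") (auto simp: odd_edge_def coxeter_edge_def)
  then obtain k where k: "n = Suc k" "even k" by (cases n) auto
  have w: "alternating a b i \<in> words Y" "alternating b a i \<in> words Y" for i
    using ab by (auto simp: alternating_def words_def)
  have "(alternating a b n, alternating b a n) \<in> artin_relations Y m"
    using ab n by (auto simp: artin_relations_def)
  then have "(alternating a b n, alternating b a n) \<in> pres_eq Y (artin_relations Y m)"
    using pres_eq.relation[of _ _ "artin_relations Y m" Y "[]" "[]"] w by simp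
  moreover have "alternating a b n = alternating a b k @ [(a, True)]"
    "alternating b a n = [(b, True)] @ alternating a b k"
    using k by (simp add: alternating_Suc, simp add: alternating_Suc_Cons)
  ultimately show ?thesis using w by (auto simp: intertwines_def)
qed

lemma odd_connected_intertwines:
  assumes "odd_connected Y m a b"
  shows "\<exists>q. intertwines Y m q [(a, True)] [(b, True)]"
proof -
  obtain p where "odd_path Y m p" "hd p = a" "last p = b"
    using assms by (auto simp: odd_connected_def)
  then show ?thesis
  proof (induction p arbitrary: a)
    case Nil
    then show ?case by (simp add: odd_path_def)
  next
    case (Cons c p)
    show ?case
    proof (cases "p = []")
      case True
      then have "a = b" "a \<in> Y" using Cons.prems by (auto simp: odd_path_def)
      then show ?thesis by (intro exI[of _ "[]"]) (simp add: intertwines_def pres_eq.refl)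
    next
      case False
      then have p: "odd_edge Y m a (hd p)" "odd_path Y m p" "last p = b"
        using Cons.prems by (auto simp: odd_path_def successively_Cons)
      obtain q where "intertwines Y m q [(hd p, True)] [(b, True)]"
        using Cons.IH[OF p(2) HOL.refl p(3)] by blast
      moreover obtain r where "intertwines Y m r [(a, True)] [(hd p, True)]"
        using odd_edge_intertwines[OF p(1)] by blast
      ultimately show ?thesis using intertwines_trans by blast
    qed
  qed
qed

lemma pres_eq_mono:
  assumes "(v, w) \<in> pres_eq X (artin_relations X m)" "X \<subseteq> S"
  shows "(v, w) \<in> pres_eq S (artin_relations S m)"
proof -
  have mono: "z \<in> words S" if "z \<in> words X" for z
    using assms(2) that by (auto simp: words_def)
  show ?thesis
    using assms(1)
  proof (induction rule: pres_eq.induct)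
    case (refl w)
    then show ?case by (intro pres_eq.refl mono)
  next
    case (sym v w)
    then show ?case by (rule_tac pres_eq.sym)
  next
    case (trans u v w)
    then show ?case by (blast intro: pres_eq.trans)
  next
    case (cancel s u v e)
    then show ?case using assms(2) mono by (intro pres_eq.cancel) auto
  next
    case (relation l r u v)
    have "(l, r) \<in> artin_relations S m"
      using relation(1) assms(2) unfolding artin_relations_def by blast
    then show ?case using relation mono by (intro pres_eq.relation) auto
  qed
qed

lemma intertwines_mono: "intertwines X m q u v \<Longrightarrow> X \<subseteq> S \<Longrightarrow> intertwines S m q u v"
  using pres_eq_mono by (auto simp: intertwines_def words_def)

section \<open>From group elements to words\<close>

definition word_class :: "'a set \<Rightarrow> ('a \<Rightarrow> 'a \<Rightarrow> enat) \<Rightarrow> 'a word \<Rightarrow> 'a word set" where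
  "word_class S m w = pres_eq S (artin_relations S m) `` {w}"

lemma carrier_artin_group: "carrier (artin_group S m) = word_class S m ` words S"
  by (auto simp: artin_group_def presented_group_def quotient_def word_class_def)

lemma word_class_eq_iff:
  "v \<in> words S \<Longrightarrow> w \<in> words S \<Longrightarrow>
    word_class S m v = word_class S m w \<longleftrightarrow> (v, w) \<in> pres_eq S (artin_relations S m)"
  unfolding word_class_def by (rule eq_equiv_class_iff[OF equiv_pres_eq])

lemma word_class_append:
  "v \<in> words S \<Longrightarrow> w \<in> words S \<Longrightarrow>
    word_class S m v \<otimes>\<^bsub>artin_group S m\<^esub> word_class S m w = word_class S m (v @ w)"
  by (simp add: word_class_def artin_group_def presented_group_mult_class)

lemma one_artin_group: "\<one>\<^bsub>artin_group S m\<^esub> = word_class S m []"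
  by (simp add: artin_group_def presented_group_def word_class_def)

lemma inv_word_class:
  assumes "w \<in> words S"
  shows "inv\<^bsub>artin_group S m\<^esub> (word_class S m w) = word_class S m (inv_word w)"
proof (rule group.inv_equality[OF group_artin_group])
  show "word_class S m (inv_word w) \<otimes>\<^bsub>artin_group S m\<^esub> word_class S m w = \<one>\<^bsub>artin_group S m\<^esub>"
    using assms by (simp add: word_class_append inv_word_words one_artin_group word_class_eq_iff inv_word_cancel)
qed (use assms in \<open>auto simp: carrier_artin_group inv_word_words\<close>)

lemma standard_parabolic_eq:
  assumes "X \<subseteq> S"
  shows "standard_parabolic S m X = word_class S m ` words X"
proof
  have mono: "z \<in> words S" if "z \<in> words X" for z using assms that by (auto simp: words_def)
  have gen: "artin_gen S m x = word_class S m [(x, True)]" for x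
    by (simp add: artin_gen_def word_class_def)
  show "standard_parabolic S m X \<subseteq> word_class S m ` words X"
    unfolding standard_parabolic_def
  proof
    fix h assume "h \<in> generate (artin_group S m) (artin_gen S m ` X)"
    then show "h \<in> word_class S m ` words X"
    proof induction
      case one
      then show ?case by (auto simp: one_artin_group)
    next
      case (incl h)
      then show ?case by (auto simp: gen)
    next
      case (inv h)
      then obtain x where "x \<in> X" "h = word_class S m [(x, True)]" by (auto simp: gen)
      then show ?case using assms by (auto simp: inv_word_class inv_word_def)
    next
      case (eng h1 h2)
      then obtain v w where "v \<in> words X" "w \<in> words X" "h1 = word_class S m v" "h2 = word_class S m w"
        by blast
      then show ?case using mono by (auto simp: word_class_append intro!: imageI)
    qed
  qed
  show "word_class S m ` words X \<subseteq> standard_parabolic S m X"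
  proof
    fix h assume "h \<in> word_class S m ` words X"
    then obtain w where "w \<in> words X" "h = word_class S m w" by blast
    then show "h \<in> standard_parabolic S m X"
    proof (induction w arbitrary: h)
      case Nil
      then show ?case by (simp add: standard_parabolic_def one_artin_group[symmetric] generate.one)
    next
      case (Cons a w)
      obtain x e where a: "a = (x, e)" by (cases a)
      have x: "x \<in> X" "x \<in> S" "w \<in> words X" using Cons.prems a assms by auto
      have "word_class S m [(x, True)] \<in> standard_parabolic S m X"
        using x by (auto simp: standard_parabolic_def gen[symmetric] intro: generate.incl)
      moreover have "word_class S m [(x, False)] \<in> standard_parabolic S m X"
        using generate.inv[of "artin_gen S m x" "artin_gen S m ` X" "artin_group S m"] x
        by (simp add: standard_parabolic_def gen inv_word_class inv_word_def)
      ultimately have "word_class S m [(x, e)] \<in> standard_parabolic S m X" by (cases e) auto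
      from generate.eng[OF this[unfolded standard_parabolic_def]
          Cons.IH[OF x(3) HOL.refl, unfolded standard_parabolic_def]]
      show ?case
        using Cons.prems x mono[OF x(3)] by (simp add: standard_parabolic_def word_class_append a)
    qed
  qed
qed

lemma conjugate_iff_intertwines:
  assumes "u \<in> words S" "v \<in> words S" "q \<in> words S"
  shows "word_class S m u = inv\<^bsub>artin_group S m\<^esub> word_class S m q
      \<otimes>\<^bsub>artin_group S m\<^esub> word_class S m v \<otimes>\<^bsub>artin_group S m\<^esub> word_class S m q
    \<longleftrightarrow> intertwines S m q u v"
proof -
  interpret group "artin_group S m" by (rule group_artin_group)
  have car: "word_class S m w \<in> carrier (artin_group S m)" if "w \<in> words S" for w
    using that by (simp add: carrier_artin_group)
  have "intertwines S m q u v \<longleftrightarrow> word_class S m (q @ u) = word_class S m (v @ q)"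
    using assms by (simp add: intertwines_def word_class_eq_iff)
  also have "\<dots> \<longleftrightarrow> word_class S m q \<otimes>\<^bsub>artin_group S m\<^esub> word_class S m u
      = word_class S m v \<otimes>\<^bsub>artin_group S m\<^esub> word_class S m q"
    using assms by (simp add: word_class_append)
  finally show ?thesis
    using inv_solve_left[of "word_class S m u" "word_class S m q"
        "word_class S m v \<otimes>\<^bsub>artin_group S m\<^esub> word_class S m q"] car assms by (auto simp: m_assoc)
qed

lemma conjugacy_stable_iff_words:
  assumes "X \<subseteq> S"
  shows "conjugacy_stable (artin_group S m) (standard_parabolic S m X) \<longleftrightarrow>
    (\<forall>u\<in>words X. \<forall>v\<in>words X. (\<exists>p. intertwines S m p u v)
      \<longrightarrow> (\<exists>q\<in>words X. intertwines S m q u v))"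
proof -
  have mono: "z \<in> words S" if "z \<in> words X" for z using assms that by (auto simp: words_def)
  have "(\<exists>p. intertwines S m p u v) \<longleftrightarrow> (\<exists>p\<in>words S. intertwines S m p u v)" for u v
    using intertwines_words by blast
  then show ?thesis
    unfolding conjugacy_stable_def standard_parabolic_eq[OF assms] carrier_artin_group
    using mono by (simp add: conjugate_iff_intertwines cong: ball_cong bex_cong)
qed

context artin_parabolic
begin

section \<open>Conjugacy stability\<close>

text \<open>Reading \<open>p u = v p\<close> from the identity state yields \<open>q u' = v q\<close>, where \<open>q\<close> is the output of \<open>p\<close>
  and \<open>u'\<close> that of \<open>u\<close> read from the state reached by \<open>p\<close>. This \<open>u'\<close> is \<open>u\<close> if \<open>p\<close> returns to the
  identity state, and consists of a single letter and its inverse otherwise.\<close>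

lemma parabolic_conjugate_to_power:
  assumes large: "large_type S m" and uv: "u \<in> words X" "v \<in> words X" and p: "intertwines S m p u v"
  shows "(\<exists>q. intertwines X m q u v) \<or> (\<exists>x\<in>X. \<exists>k q. intertwines X m q (power_word x k) v)"
proof (cases "X = {}")
  case True
  then have "u = []" "v = []" using uv by (auto simp: words_def)
  then show ?thesis by (intro disjI1 exI[of _ "[]"]) (simp add: intertwines_def pres_eq.refl)
next
  case False
  let ?E = "pres_eq X (artin_relations X m)" and ?g = "run id p" and ?q = "out id p"
  have pS: "p \<in> words S" using intertwines_words[OF p] by blast
  have q: "?q \<in> words X" using pS by (rule out_in_words)
  have g: "?g \<in> states" using run_in_states[OF id_in_states pS] .
  have "(out id (p @ u), out id (v @ p)) \<in> ?E"
    using retraction_respects[OF _ id_in_states] p unfolding intertwines_def by blast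
  then have E: "intertwines X m ?q (out ?g u) v"
    using q uv(2) by (simp add: intertwines_def id_run)
  show ?thesis
  proof (cases "?g = id")
    case True
    then show ?thesis using E uv(1) by (auto simp: id_run)
  next
    case False
    obtain x where x: "x \<in> X" "out ?g u \<in> words {x}"
      using single_emission[OF large g False \<open>X \<noteq> {}\<close>] uv(1) by metis
    let ?w = "power_word x (exponent_sum {x} (out ?g u))"
    have "(?q @ ?w, ?q @ out ?g u) \<in> ?E"
      using pres_eq_append[OF pres_eq.refl[OF q] pres_eq.sym[OF single_letter_word[OF x]]] .
    then have "intertwines X m ?q ?w v"
      using E q unfolding intertwines_def by (blast intro: pres_eq.trans)
    then show ?thesis using x(1) by blast
  qed
qed

text \<open>Unless \<open>u\<close> and \<open>v\<close> are conjugate at once, both are conjugate to powers of letters of \<open>X\<close>, the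
  other power being obtained from the inverse conjugation. Exponent sums over the odd
  components of the two letters in \<open>S\<close> then identify the exponents and relate the letters.\<close>

lemma conjugate_in_parabolic:
  assumes large: "large_type S m" and uv: "u \<in> words X" "v \<in> words X" and p: "intertwines S m p u v"
    and odd: "\<And>a b. a \<in> X \<Longrightarrow> b \<in> X \<Longrightarrow> odd_connected S m a b \<Longrightarrow> odd_connected X m a b"
  shows "\<exists>q. intertwines X m q u v"
proof (rule ccontr)
  assume no: "\<nexists>q. intertwines X m q u v"
  then obtain x k q where v: "x \<in> X" "intertwines X m q (power_word x k) v"
    using parabolic_conjugate_to_power[OF large uv p] by blast
  obtain x' k' q' where u: "x' \<in> X" "intertwines X m q' (power_word x' k') u"
    using parabolic_conjugate_to_power[OF large uv(2,1) intertwines_inverse[OF p]]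
      intertwines_inverse no by blast
  have S: "x \<in> S" "x' \<in> S" using u v X_subset by auto
  obtain r where "intertwines S m r (power_word x' k') (power_word x k)"
    using u(2) v(2) p X_subset intertwines_trans intertwines_inverse intertwines_mono by metis
  then have r: "(r @ power_word x' k', power_word x k @ r) \<in> pres_eq S (artin_relations S m)"
    by (simp add: intertwines_def)
  have "exponent_sum {b. odd_connected S m a b} (power_word x' k')
      = exponent_sum {b. odd_connected S m a b} (power_word x k)" for a
    using exponent_sum_pres_eq[OF r, of "{b. odd_connected S m a b}"] odd_component_closed[OF labels] by simp
  from this[of x] this[of x'] have kk: "k' = k" "k = 0 \<or> odd_connected S m x' x"
    using odd_connected_refl[OF S(1), of m] odd_connected_refl[OF S(2), of m]
    by (auto split: if_splits)
  have "\<exists>q. intertwines X m q (power_word x' k') (power_word x k)"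
  proof (cases "k = 0")
    case True
    then show ?thesis using kk by (intro exI[of _ "[]"]) (simp add: intertwines_def pres_eq.refl)
  next
    case False
    then have "odd_connected X m x' x" using kk odd u v by blast
    then obtain q where "intertwines X m q [(x', True)] [(x, True)]"
      using odd_connected_intertwines[of X m x' x] by auto
    from intertwines_power_word[OF this] show ?thesis using kk(1) by blast
  qed
  then show False using u v intertwines_trans intertwines_inverse no by blast
qed

end

theorem theoremC:
  fixes S X :: "'a set" and m :: "'a \<Rightarrow> 'a \<Rightarrow> enat"
  assumes "finite S"
    and "artin_labels S m"
    and "large_type S m"
    and "X \<subseteq> S"
  shows "\<not> conjugacy_stable (artin_group S m) (standard_parabolic S m X) \<longleftrightarrow>
    (\<exists>a\<in>X. \<exists>b\<in>X. odd_connected S m a b \<and> \<not> odd_connected X m a b)"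
proof -
  interpret artin_parabolic S m X
    using assms by unfold_locales
  have labels_X: "artin_labels X m" using assms by (auto simp: artin_labels_def)
  show ?thesis
  proof
    assume "\<not> conjugacy_stable (artin_group S m) (standard_parabolic S m X)"
    then obtain u v p where "u \<in> words X" "v \<in> words X" "intertwines S m p u v"
      "\<not> (\<exists>q\<in>words X. intertwines S m q u v)"
      by (auto simp: conjugacy_stable_iff_words[OF assms(4)])
    then show "\<exists>a\<in>X. \<exists>b\<in>X. odd_connected S m a b \<and> \<not> odd_connected X m a b"
      using conjugate_in_parabolic[OF assms(3)] intertwines_mono[OF _ assms(4)] intertwines_words by metis
  next
    assume "\<exists>a\<in>X. \<exists>b\<in>X. odd_connected S m a b \<and> \<not> odd_connected X m a b"
    then obtain a b where ab: "a \<in> X" "b \<in> X" "odd_connected S m a b" "\<not> odd_connected X m a b"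
      by blast
    show "\<not> conjugacy_stable (artin_group S m) (standard_parabolic S m X)"
    proof
      assume "conjugacy_stable (artin_group S m) (standard_parabolic S m X)"
      moreover have "\<exists>p. intertwines S m p [(a, True)] [(b, True)]"
        using odd_connected_intertwines[OF ab(3)] .
      ultimately obtain q where q: "q \<in> words X" "intertwines S m q [(a, True)] [(b, True)]"
        using ab unfolding conjugacy_stable_iff_words[OF assms(4)]
        by (metis fst_conv words_simps(1,2))
      then have "(q @ [(a, True)], [(b, True)] @ q) \<in> pres_eq X (artin_relations X m)"
        using ab by (intro parabolic_embeds) (auto simp: intertwines_def)
      from exponent_sum_pres_eq[OF this, of "{c. odd_connected X m a c}"]
      show False
        using odd_component_closed[OF labels_X] odd_connected_refl[OF ab(1)] ab(4) by simp
    qed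
  qed
qed

end
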